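(* Assume exactness. Let $\{x_k\}_{k\ge 0}$ be the random iterates produced by the method mSGD/mSN/mSPP, started with $x_0,x_1\in\mathbb{R}^n$ satisfying $x_0-x_1\in\mathrm{Range}(\mathbf{B}^{-1}\mathbf{A}^\top)$, with stepsize $0<\omega\le 1/\lambda_{\max}$ and momentum parameter $\left(1-\sqrt{\omega\lambda_{\min}^+}\right)^2<\beta<1$. Let $x_*=\Pi^{\mathbf{B}}_{\mathcal{L}}(x_0)$. Then there exists a constant $C>0$ such that for all $k\ge 0$ $$\|\mathbb{E}[x_k-x_*]\|_{\mathbf{B}}^2\le\beta^k C.$$ (i) In particular, if $\omega=1$ and $\beta=\left(1-\sqrt{0.99\,\lambda_{\min}^+}\right)^2$, then $\|\mathbb{E}[x_k-x_*]\|_{\mathbf{B}}^2\le\beta^kC$ and the iteration complexity is $\tilde{O}\left(\sqrt{1/\lambda_{\min}^+}\right)$. (ii) If $\omega=1/\lambda_{\max}$ and $\beta=\left(1-\sqrt{\frac{0.99\,\lambda_{\min}^+}{\lambda_{\max}}}\right)^2$, then $\|\mathbb{E}[x_k-x_*]\|_{\mathbf{B}}^2\le\beta^kC$ and the iteration complexity is $\tilde{O}\left(\sqrt{\lambda_{\max}/\lambda_{\min}^+}\right)$.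
   Context: Let $\mathbf{A}\in\mathbb{R}^{m\times n}$ and $b\in\mathbb{R}^m$ be such that the linear system $\mathbf{A}x=b$ is consistent, with solution set $\mathcal{L}=\{x\in\mathbb{R}^n:\mathbf{A}x=b\}$. Let $\mathbf{B}\in\mathbb{R}^{n\times n}$ be symmetric positive definite, $\langle x,z\rangle_{\mathbf{B}}:=x^\top\mathbf{B}z$, $\|x\|_{\mathbf{B}}:=(x^\top\mathbf{B}x)^{1/2}$; $\Pi^{\mathbf{B}}_{\mathcal{L}}(x)$ is the projection of $x$ onto $\mathcal{L}$ in the norm $\|\cdot\|_{\mathbf{B}}$. Let $\mathcal{D}$ be an arbitrary probability distribution over real matrices $\mathbf{S}$ with $m$ rows. For such $\mathbf{S}$ define $$\mathbf{H}:=\mathbf{S}(\mathbf{S}^\top\mathbf{A}\mathbf{B}^{-1}\mathbf{A}^\top\mathbf{S})^\dagger\mathbf{S}^\top,\quad \mathbf{Z}:=\mathbf{A}^\top\mathbf{H}\mathbf{A},\quad f_{\mathbf{S}}(x):=\tfrac12(\mathbf{A}x-b)^\top\mathbf{H}(\mathbf{A}x-b),$$ where $\dagger$ is the Moore–Penrose pseudoinverse, and $f(x):=\mathbb{E}_{\mathbf{S}\sim\mathcal{D}}[f_{\mathbf{S}}(x)]$. Gradients are with respect to $\langle\cdot,\cdot\rangle_{\mathbf{B}}$, so $\nabla f_{\mathbf{S}}(x)=\mathbf{B}^{-1}\mathbf{A}^\top\mathbf{H}(\mathbf{A}x-b)$. Let $\mathbf{W}:=\mathbf{B}^{-1/2}\mathbb{E}[\mathbf{Z}]\mathbf{B}^{-1/2}$;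 all its eigenvalues lie in $[0,1]$; $\lambda_{\max}$ is its largest eigenvalue and $\lambda_{\min}^+$ its smallest nonzero eigenvalue (it is presupposed that $\mathbf{W}\neq 0$, so that this is defined). Exactness means: the set of minimizers of $f$ equals $\mathcal{L}$. The method mSGD/mSN/mSPP (one and the same iteration) with stepsize $\omega$ and momentum parameter $\beta$: given deterministic $x_0,x_1\in\mathbb{R}^n$, for each $k\ge 1$ draw a fresh independent $\mathbf{S}_k\sim\mathcal{D}$ and set $$x_{k+1}=x_k-\omega\nabla f_{\mathbf{S}_k}(x_k)+\beta(x_k-x_{k-1}).$$ "The iteration complexity is $\tilde{O}(T)$" means: there is an absolute constant $c>0$ such that for every $0<\varepsilon<C$, every $k\ge c\,T\log(C/\varepsilon)$ satisfies $\beta^kC\le\varepsilon$, and hence $\|\mathbb{E}[x_k-x_*]\|_{\mathbf{B}}^2\le\varepsilon$. The constant $C$ may depend on everything except $k$ (in particular on the starting points). *)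

theory Defs
  imports
    "HOL-Probability.Probability"
    "Jordan_Normal_Form.Gauss_Jordan_Elimination"
    "Jordan_Normal_Form.Char_Poly"
begin

(* The matrices are those of Jordan_Normal_Form, because the number of columns of a sampled
   matrix is itself random and because one absolute constant has to serve all dimensions. *)

unbundle no vec_syntax
hide_type (open) Finite_Cartesian_Product.vec
hide_const (open) Finite_Cartesian_Product.vec Finite_Cartesian_Product.mat

definition sym_pos_def :: "real mat \<Rightarrow> bool" where
  "sym_pos_def M \<longleftrightarrow> M \<in> carrier_mat (dim_row M) (dim_row M) \<and> M\<^sup>T = M \<and>
     (\<forall>v \<in> carrier_vec (dim_row M). v \<noteq> 0\<^sub>v (dim_row M) \<longrightarrow> 0 < scalar_prod v (M *\<^sub>v v))"

definition sym_pos_semidef :: "real mat \<Rightarrow> bool" where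
  "sym_pos_semidef M \<longleftrightarrow> M \<in> carrier_mat (dim_row M) (dim_row M) \<and> M\<^sup>T = M \<and>
     (\<forall>v \<in> carrier_vec (dim_row M). 0 \<le> scalar_prod v (M *\<^sub>v v))"

definition mat_inv :: "real mat \<Rightarrow> real mat" where
  "mat_inv M = the (mat_inverse M)"

definition mat_sqrt :: "real mat \<Rightarrow> real mat" where
  "mat_sqrt M = (THE R. R \<in> carrier_mat (dim_row M) (dim_row M) \<and> sym_pos_semidef R \<and> R * R = M)"

definition mat_range :: "real mat \<Rightarrow> real vec set" where
  "mat_range M = (\<lambda>y. M *\<^sub>v y) ` carrier_vec (dim_col M)"

(* the four Penrose conditions, for real matrices *)
definition is_moore_penrose :: "real mat \<Rightarrow> real mat \<Rightarrow> bool" where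
  "is_moore_penrose M X \<longleftrightarrow> X \<in> carrier_mat (dim_col M) (dim_row M) \<and>
     M * X * M = M \<and> X * M * X = X \<and> (M * X)\<^sup>T = M * X \<and> (X * M)\<^sup>T = X * M"

definition pinv :: "real mat \<Rightarrow> real mat" where
  "pinv M = (THE X. is_moore_penrose M X)"

definition inner_B :: "real mat \<Rightarrow> real vec \<Rightarrow> real vec \<Rightarrow> real" where
  "inner_B B x z = scalar_prod x (B *\<^sub>v z)"

definition norm_B :: "real mat \<Rightarrow> real vec \<Rightarrow> real" where
  "norm_B B x = sqrt (inner_B B x x)"

definition proj_B :: "real mat \<Rightarrow> real vec set \<Rightarrow> real vec \<Rightarrow> real vec" where
  "proj_B B L x = (ARG_MIN (\<lambda>z. norm_B B (x - z)) z. z \<in> L)"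

(* Frechet gradient with respect to the inner product of B *)
definition has_gradient_B :: "real mat \<Rightarrow> (real vec \<Rightarrow> real) \<Rightarrow> real vec \<Rightarrow> real vec \<Rightarrow> bool" where
  "has_gradient_B B f g x \<longleftrightarrow> g \<in> carrier_vec (dim_row B) \<and>
     (\<forall>e>0. \<exists>d>0. \<forall>h \<in> carrier_vec (dim_row B). norm_B B h < d \<longrightarrow>
        \<bar>f (x + h) - f x - inner_B B g h\<bar> \<le> e * norm_B B h)"

definition gradient_B :: "real mat \<Rightarrow> (real vec \<Rightarrow> real) \<Rightarrow> real vec \<Rightarrow> real vec" where
  "gradient_B B f x = (THE g. has_gradient_B B f g x)"

definition solutions :: "real mat \<Rightarrow> real vec \<Rightarrow> real vec set" where
  "solutions A b = {x \<in> carrier_vec (dim_col A). A *\<^sub>v x = b}"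

(* Borel sigma-algebra on the disjoint union, over all column numbers q, of the spaces of
   real m x q matrices *)
definition mat_space :: "nat \<Rightarrow> real mat measure" where
  "mat_space m = sigma {S. dim_row S = m}
     (range (carrier_mat m) \<union>
      {{S \<in> carrier_mat m q. S $$ (i, j) \<le> c} | q i j c. i < m \<and> j < q})"

definition expect_vec :: "'w measure \<Rightarrow> nat \<Rightarrow> ('w \<Rightarrow> real vec) \<Rightarrow> real vec" where
  "expect_vec M n X = Matrix.vec n (\<lambda>i. \<integral>w. X w $ i \<partial>M)"

definition expect_mat :: "'w measure \<Rightarrow> nat \<Rightarrow> nat \<Rightarrow> ('w \<Rightarrow> real mat) \<Rightarrow> real mat" where
  "expect_mat M r c X = Matrix.mat r c (\<lambda>(i, j). \<integral>w. X w $$ (i, j) \<partial>M)"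

definition H_mat :: "real mat \<Rightarrow> real mat \<Rightarrow> real mat \<Rightarrow> real mat" where
  "H_mat A B S = S * pinv (S\<^sup>T * A * mat_inv B * A\<^sup>T * S) * S\<^sup>T"

definition Z_mat :: "real mat \<Rightarrow> real mat \<Rightarrow> real mat \<Rightarrow> real mat" where
  "Z_mat A B S = A\<^sup>T * H_mat A B S * A"

definition f_sample :: "real mat \<Rightarrow> real vec \<Rightarrow> real mat \<Rightarrow> real mat \<Rightarrow> real vec \<Rightarrow> real" where
  "f_sample A b B S x = 1 / 2 * scalar_prod (A *\<^sub>v x - b) (H_mat A B S *\<^sub>v (A *\<^sub>v x - b))"

definition f_mean :: "real mat \<Rightarrow> real vec \<Rightarrow> real mat \<Rightarrow> real mat measure \<Rightarrow> real vec \<Rightarrow> real" where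
  "f_mean A b B D x = (\<integral>S. f_sample A b B S x \<partial>D)"

definition exactness :: "real mat \<Rightarrow> real vec \<Rightarrow> real mat \<Rightarrow> real mat measure \<Rightarrow> bool" where
  "exactness A b B D \<longleftrightarrow>
     {x \<in> carrier_vec (dim_col A). \<forall>y \<in> carrier_vec (dim_col A). f_mean A b B D x \<le> f_mean A b B D y}
       = solutions A b"

definition W_mat :: "real mat \<Rightarrow> real mat \<Rightarrow> real mat measure \<Rightarrow> real mat" where
  "W_mat A B D = mat_sqrt (mat_inv B)
     * expect_mat D (dim_col A) (dim_col A) (Z_mat A B) * mat_sqrt (mat_inv B)"

definition lambda_max :: "real mat \<Rightarrow> real" where
  "lambda_max W = Max {l. eigenvalue W l}"

definition lambda_min_nz :: "real mat \<Rightarrow> real" where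
  "lambda_min_nz W = Min {l. eigenvalue W l \<and> l \<noteq> 0}"

(* s k is the matrix sampled in step k; s 0 is not used *)
fun iterate :: "real mat \<Rightarrow> real vec \<Rightarrow> real mat \<Rightarrow> real \<Rightarrow> real \<Rightarrow> real vec \<Rightarrow> real vec \<Rightarrow>
    (nat \<Rightarrow> real mat) \<Rightarrow> nat \<Rightarrow> real vec" where
  "iterate A b B \<omega> \<beta> x0 x1 s 0 = x0"
| "iterate A b B \<omega> \<beta> x0 x1 s (Suc 0) = x1"
| "iterate A b B \<omega> \<beta> x0 x1 s (Suc (Suc k)) =
     iterate A b B \<omega> \<beta> x0 x1 s (Suc k)
       - \<omega> \<cdot>\<^sub>v gradient_B B (f_sample A b B (s (Suc k))) (iterate A b B \<omega> \<beta> x0 x1 s (Suc k))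
       + \<beta> \<cdot>\<^sub>v (iterate A b B \<omega> \<beta> x0 x1 s (Suc k) - iterate A b B \<omega> \<beta> x0 x1 s k)"

(* squared B-norm of the expected error of the k-th iterate; the samples are i.i.d. with law D
   (coordinates of the infinite product space) *)
definition mean_error_sq :: "real mat \<Rightarrow> real vec \<Rightarrow> real mat \<Rightarrow> real mat measure \<Rightarrow> real \<Rightarrow> real \<Rightarrow>
    real vec \<Rightarrow> real vec \<Rightarrow> nat \<Rightarrow> real" where
  "mean_error_sq A b B D \<omega> \<beta> x0 x1 k =
     (norm_B B (expect_vec (Pi\<^sub>M UNIV (\<lambda>_::nat. D)) (dim_col A)
        (\<lambda>s. iterate A b B \<omega> \<beta> x0 x1 s k - proj_B B (solutions A b) x0)))\<^sup>2"

(* iteration complexity O~(T) with constant c, for errors err k bounded by \<beta>^k C *)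
definition complexity_with :: "real \<Rightarrow> real \<Rightarrow> real \<Rightarrow> real \<Rightarrow> (nat \<Rightarrow> real) \<Rightarrow> bool" where
  "complexity_with c T \<beta> C err \<longleftrightarrow>
     (\<forall>\<epsilon> k. 0 < \<epsilon> \<longrightarrow> \<epsilon> < C \<longrightarrow> c * T * ln (C / \<epsilon>) \<le> real k \<longrightarrow> \<beta> ^ k * C \<le> \<epsilon> \<and> err k \<le> \<epsilon>)"

end

theory Submission
  imports Defs "Jordan_Normal_Form.Spectral_Radius"
begin

text \<open>Let \<open>R\<close> be the symmetric positive square root of the inverse of \<open>B\<close>, and \<open>Ri\<close> the inverse of
\<open>R\<close>. In the whitened coordinates \<open>Ri x\<close> the \<open>B\<close>-norm is the Euclidean norm, and the matrix
\<open>P\<^sub>S = R Z\<^sub>S R\<close> is the orthogonal projection onto the range of \<open>R A\<^sup>T S\<close>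
(lemma \<open>sketch_proj_facts\<close>). If \<open>y\<close> is any solution of the system, the sampled gradient at \<open>x\<close> becomes
\<open>P\<^sub>S Ri (x - y)\<close> (lemma \<open>gradient_f_sample\<close>), so the errors \<open>e\<^sub>k = Ri (x\<^sub>k - y)\<close> satisfy a linear
second-order recursion whose only random coefficient is a projection. The fresh sample is independent of the
past, hence the means \<open>r\<^sub>k\<close> of the errors satisfy the deterministic recursion
\<open>r\<^sub>k\<^sub>+\<^sub>2 = ((1 + \<beta>) I - \<omega> W) r\<^sub>k\<^sub>+\<^sub>1 - \<beta> r\<^sub>k\<close>, where \<open>W = E[P\<^sub>S]\<close> is the matrix of the statement
(lemmas \<open>W_mat_eq\<close> and \<open>mean_err_step\<close>).

An orthonormal eigenbasis of \<open>W\<close> decouples the recursion into scalar ones, \<open>a\<^sub>k\<^sub>+\<^sub>2 = t a\<^sub>k\<^sub>+\<^sub>1 - \<beta> a\<^sub>k\<close> with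
\<open>t = 1 + \<beta> - \<omega> d\<close> for an eigenvalue \<open>d\<close>. If \<open>d\<close> is nonzero, the bounds on \<open>\<omega>\<close> and \<open>\<beta>\<close> imply that
\<open>t\<^sup>2 < 4 \<beta>\<close> (lemma \<open>momentum_discriminant\<close>): the characteristic roots are complex with modulus
\<open>sqrt \<beta>\<close>, and \<open>a\<^sub>k\<^sup>2\<close> is bounded by a multiple of \<open>\<beta>\<^sup>k\<close>. Complex roots can be avoided because the
form \<open>a\<^sub>k\<^sub>+\<^sub>1\<^sup>2 - t a\<^sub>k\<^sub>+\<^sub>1 a\<^sub>k + \<beta> a\<^sub>k\<^sup>2\<close> is multiplied by exactly \<open>\<beta>\<close> in each step, and it is positive
definite (lemma \<open>momentum_recursion_bound\<close>). If \<open>d = 0\<close>, there is no decay, but the component is zero for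
all \<open>k\<close>: exactness puts the kernel of \<open>W\<close> inside the kernel of \<open>A R\<close>, and both starting errors lie in the
range of \<open>R A\<^sup>T\<close>, the first because \<open>y\<close> is the projection of \<open>x\<^sub>0\<close>, the second by the assumption on
\<open>x\<^sub>0 - x\<^sub>1\<close> (lemmas \<open>exactness_kernel\<close> and \<open>projection_onto_solutions\<close>). The complexity bounds
hold with constant 1, since \<open>(1 - \<tau>) ^ (2 k) \<le> exp (- 2 \<tau> k)\<close>.

Two ingredients need work of their own. The spectral theorem for real symmetric matrices is proved by
deflation with Householder reflections; pseudoinverses, square roots and whitening all come from it.
The pseudoinverse is not a continuous function of its argument, so the measurability of \<open>S \<mapsto> P\<^sub>S\<close> is obtained
by writing the entries of \<open>I - P\<^sub>S\<close> as pointwise limits of polynomials in the entries of \<open>S S\<^sup>T\<close> and one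
measurable scalar (lemmas \<open>landweber_limit\<close> and \<open>sketch_proj_measurable\<close>).\<close>

unbundle no inner_syntax

section \<open>Matrices with explicit dimensions\<close>

text \<open>With carrier premises the inner dimensions would be free variables that the simplifier has to guess. In
terms of \<open>dim_row\<close> and \<open>dim_col\<close> the side conditions are rewritten to true, and products
of rectangular matrices can be normalized automatically.\<close>

lemma mult_assoc_dim:
  fixes A :: "'a::semiring_0 mat"
  assumes "dim_col A = dim_row B" "dim_col B = dim_row C"
  shows "A * B * C = A * (B * C)"
  by (rule assoc_mult_mat[of A "dim_row A" "dim_col A" B "dim_col B" C "dim_col C"])
    (rule carrier_matI; simp add: assms)+

lemma mult_vec_assoc_dim:
  fixes A :: "'a::semiring_0 mat"
  assumes "dim_col A = dim_row B" "dim_col B = dim_vec v"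
  shows "A * B *\<^sub>v v = A *\<^sub>v (B *\<^sub>v v)"
  by (rule assoc_mult_mat_vec[of A "dim_row A" "dim_col A" B "dim_col B" v])
    (rule carrier_matI carrier_vecI; simp add: assms)+

lemma transpose_mult_dim:
  fixes A :: "'a::comm_semiring_0 mat"
  assumes "dim_col A = dim_row B"
  shows "(A * B)\<^sup>T = B\<^sup>T * A\<^sup>T"
  by (rule transpose_mult[of A "dim_row A" "dim_col A" B "dim_col B"])
    (rule carrier_matI; simp add: assms)+

lemma scalar_prod_transpose_dim:
  fixes A :: "'a::comm_semiring_0 mat"
  assumes "dim_vec u = dim_row A" "dim_vec v = dim_col A"
  shows "(A\<^sup>T *\<^sub>v u) \<bullet> v = u \<bullet> (A *\<^sub>v v)"
  by (rule transpose_vec_mult_scalar[of A "dim_row A" "dim_col A" v u])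
    (rule carrier_matI carrier_vecI; simp add: assms)+

lemma scalar_prod_commute_dim:
  fixes u :: "'a::comm_semiring_0 vec"
  assumes "dim_vec u = dim_vec v"
  shows "u \<bullet> v = v \<bullet> u"
  by (rule comm_scalar_prod[of u "dim_vec u" v]) (rule carrier_vecI; simp add: assms)+

section \<open>Real vectors and the spectral theorem\<close>

lemma scalar_prod_self_real: "(v::real vec) \<bullet> v = (\<Sum>i<dim_vec v. (v $ i)\<^sup>2)"
  by (simp add: scalar_prod_def power2_eq_square atLeast0LessThan)

lemma scalar_prod_self_nonneg: "(v::real vec) \<bullet> v \<ge> 0"
  by (simp add: scalar_prod_self_real sum_nonneg)

lemma scalar_prod_self_eq_0:
  assumes "(v::real vec) \<in> carrier_vec n"
  shows "v \<bullet> v = 0 \<longleftrightarrow> v = 0\<^sub>v n"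
proof -
  have "v \<bullet> v = 0 \<longleftrightarrow> (\<forall>i<dim_vec v. v $ i = 0)"
    unfolding scalar_prod_self_real by (subst sum_nonneg_eq_0_iff) auto
  then show ?thesis using assms by (auto simp: vec_eq_iff)
qed

lemma scalar_prod_self_pos:
  assumes "(v::real vec) \<in> carrier_vec n" "v \<noteq> 0\<^sub>v n"
  shows "v \<bullet> v > 0"
  using assms(2) scalar_prod_self_nonneg[of v] scalar_prod_self_eq_0[OF assms(1)]
  by (simp add: less_le)

text \<open>A complex eigenvalue exists by the fundamental theorem of algebra. With \<open>z = x + i y\<close> the eigenvector,
comparing \<open>(A x) \<bullet> y\<close> with \<open>x \<bullet> (A y)\<close> gives \<open>Im l * (|x|\<^sup>2 + |y|\<^sup>2) = 0\<close>, so the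
eigenvalue is real, and whichever of \<open>x\<close> and \<open>y\<close> is nonzero is a real eigenvector.\<close>

lemma symmetric_real_eigenvector:
  fixes A :: "real mat"
  assumes A: "A \<in> carrier_mat n n" and sym: "A\<^sup>T = A" and n: "n > 0"
  obtains v a where "v \<in> carrier_vec n" "v \<bullet> v = 1" "A *\<^sub>v v = a \<cdot>\<^sub>v v"
proof -
  define Ac where "Ac = map_mat complex_of_real A"
  have Ac: "Ac \<in> carrier_mat n n" using A by (simp add: Ac_def)
  from spectrum_non_empty[OF Ac n] obtain l where "eigenvalue Ac l"
    by (auto simp: spectrum_def)
  then obtain z where z: "z \<in> carrier_vec n" "z \<noteq> 0\<^sub>v n" "Ac *\<^sub>v z = l \<cdot>\<^sub>v z"
    using Ac by (auto simp: eigenvalue_def eigenvector_def)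
  define x where "x = map_vec Re z"
  define y where "y = map_vec Im z"
  have x: "x \<in> carrier_vec n" and y: "y \<in> carrier_vec n" using z by (auto simp: x_def y_def)
  have comp: "(\<Sum>j<n. complex_of_real (A $$ (i,j)) * z $ j) = l * z $ i" if "i < n" for i
  proof -
    have "(Ac *\<^sub>v z) $ i = l * z $ i" using z that by simp
    then show ?thesis using A z(1) that
      by (simp add: Ac_def scalar_prod_def atLeast0LessThan)
  qed
  have Ax: "A *\<^sub>v x = Re l \<cdot>\<^sub>v x - Im l \<cdot>\<^sub>v y"
  proof (rule eq_vecI)
    fix i assume "i < dim_vec (Re l \<cdot>\<^sub>v x - Im l \<cdot>\<^sub>v y)"
    then have i: "i < n" using y by simp
    show "(A *\<^sub>v x) $ i = (Re l \<cdot>\<^sub>v x - Im l \<cdot>\<^sub>v y) $ i"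
      using arg_cong[OF comp[OF i], of Re] i A z(1)
      by (simp add: scalar_prod_def atLeast0LessThan x_def y_def)
  qed (simp_all add: carrier_matD[OF A] carrier_vecD[OF x] carrier_vecD[OF y])
  have Ay: "A *\<^sub>v y = Re l \<cdot>\<^sub>v y + Im l \<cdot>\<^sub>v x"
  proof (rule eq_vecI)
    fix i assume "i < dim_vec (Re l \<cdot>\<^sub>v y + Im l \<cdot>\<^sub>v x)"
    then have i: "i < n" using x by simp
    show "(A *\<^sub>v y) $ i = (Re l \<cdot>\<^sub>v y + Im l \<cdot>\<^sub>v x) $ i"
      using arg_cong[OF comp[OF i], of Im] i A z(1)
      by (simp add: scalar_prod_def atLeast0LessThan x_def y_def)
  qed (simp_all add: carrier_matD[OF A] carrier_vecD[OF x] carrier_vecD[OF y])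
  have xy: "x \<noteq> 0\<^sub>v n \<or> y \<noteq> 0\<^sub>v n"
    using z by (auto simp: vec_eq_iff x_def y_def complex_eq_iff)
  have "(A *\<^sub>v x) \<bullet> y = x \<bullet> (A *\<^sub>v y)"
    using scalar_prod_transpose_dim[of x A y] A x y sym by simp
  then have "Im l * (x \<bullet> x + y \<bullet> y) = 0"
    unfolding Ax Ay using x y
    by (simp add: minus_scalar_prod_distrib[of _ n] scalar_prod_add_distrib[of _ n]
        scalar_prod_commute_dim[of y x] algebra_simps)
  moreover have "x \<bullet> x + y \<bullet> y \<noteq> 0"
    using xy scalar_prod_self_nonneg[of x] scalar_prod_self_nonneg[of y]
      scalar_prod_self_pos[OF x] scalar_prod_self_pos[OF y] by fastforce
  ultimately have im: "Im l = 0" by simp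
  have "\<exists>w. w \<in> carrier_vec n \<and> w \<noteq> 0\<^sub>v n \<and> A *\<^sub>v w = Re l \<cdot>\<^sub>v w"
  proof (cases "x = 0\<^sub>v n")
    case True
    have "A *\<^sub>v y = Re l \<cdot>\<^sub>v y" unfolding Ay im using x y by (auto simp: vec_eq_iff)
    then show ?thesis using xy True y by blast
  next
    case False
    have "A *\<^sub>v x = Re l \<cdot>\<^sub>v x" unfolding Ax im using x y by (auto simp: vec_eq_iff)
    then show ?thesis using False x by blast
  qed
  then obtain w where w: "w \<in> carrier_vec n" "w \<noteq> 0\<^sub>v n" "A *\<^sub>v w = Re l \<cdot>\<^sub>v w" by blast
  define t where "t = 1 / sqrt (w \<bullet> w)"
  have pos: "w \<bullet> w > 0"
    using scalar_prod_self_pos w by blast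
  show ?thesis
  proof (rule that[of "t \<cdot>\<^sub>v w" "Re l"])
    show "t \<cdot>\<^sub>v w \<in> carrier_vec n" using w by simp
    show "(t \<cdot>\<^sub>v w) \<bullet> (t \<cdot>\<^sub>v w) = 1" using w pos by (simp add: t_def)
    show "A *\<^sub>v (t \<cdot>\<^sub>v w) = Re l \<cdot>\<^sub>v (t \<cdot>\<^sub>v w)"
      using w mult_mat_vec[OF A w(1), of t] by (simp add: smult_smult_assoc mult.commute)
  qed
qed

text \<open>The reflection in the hyperplane orthogonal to \<open>v - e\<^sub>0\<close> exchanges the unit vectors \<open>e\<^sub>0\<close> and \<open>v\<close>.
It is an orthogonal matrix with prescribed first column, and being an involution it is its own inverse.\<close>

lemma householder_reflection:
  fixes v :: "real vec"
  assumes v: "v \<in> carrier_vec n" and unit: "v \<bullet> v = 1" and n: "n > 0"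
  obtains H where "H \<in> carrier_mat n n" "H\<^sup>T = H" "H * H = 1\<^sub>m n" "H *\<^sub>v unit_vec n 0 = v"
proof (cases "v = unit_vec n 0")
  case True
  show ?thesis by (rule that[of "1\<^sub>m n"]) (simp_all add: True)
next
  case False
  define e :: "real vec" where "e = unit_vec n 0"
  define w where "w = v - e"
  define c where "c = 2 / (w \<bullet> w)"
  have e: "e \<in> carrier_vec n" and w: "w \<in> carrier_vec n" using v by (auto simp: e_def w_def)
  have ww: "w \<bullet> w = 2 - 2 * v $ 0"
    using v n unit unfolding w_def
    by (simp add: minus_scalar_prod_distrib[of _ n] scalar_prod_minus_distrib[of _ n] e_def)
  have "w \<noteq> 0\<^sub>v n" using False v e by (auto simp: w_def e_def vec_eq_iff)
  then have wne: "w \<bullet> w \<noteq> 0" using scalar_prod_self_eq_0[OF w] by simp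
  define H where "H = Matrix.mat n n (\<lambda>(i,j). (if i = j then 1 else 0) - c * w $ i * w $ j)"
  have H: "H \<in> carrier_mat n n" by (simp add: H_def)
  have Happ: "H *\<^sub>v u = u - (c * (w \<bullet> u)) \<cdot>\<^sub>v w" if u: "u \<in> carrier_vec n" for u
  proof (rule eq_vecI)
    fix i assume "i < dim_vec (u - (c * (w \<bullet> u)) \<cdot>\<^sub>v w)"
    then have i: "i < n" using w by simp
    have "(H *\<^sub>v u) $ i = (\<Sum>j<n. ((if i = j then 1 else 0) - c * w $ i * w $ j) * u $ j)"
      using i u by (simp add: H_def scalar_prod_def atLeast0LessThan)
    also have "\<dots> = (\<Sum>j<n. (if i = j then u $ j else 0) - c * w $ i * (w $ j * u $ j))"
      by (intro sum.cong) (auto simp: algebra_simps)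
    also have "\<dots> = (u - (c * (w \<bullet> u)) \<cdot>\<^sub>v w) $ i"
      using i u w by (simp add: scalar_prod_def atLeast0LessThan sum_distrib_left[symmetric]
          sum_subtractf)
    finally show "(H *\<^sub>v u) $ i = (u - (c * (w \<bullet> u)) \<cdot>\<^sub>v w) $ i" .
  qed (simp_all add: carrier_matD[OF H] carrier_vecD[OF u] carrier_vecD[OF w])
  show ?thesis
  proof (rule that[OF H])
    show "H\<^sup>T = H" by (rule eq_matI) (auto simp: H_def)
    show "H * H = 1\<^sub>m n"
    proof (rule mat_col_eqI)
      fix j assume "j < dim_col (1\<^sub>m n)"
      then have j: "j < n" by simp
      have colH: "col H j = H *\<^sub>v unit_vec n j"
        using j by (intro eq_vecI) (auto simp: H_def)
      have "H *\<^sub>v (H *\<^sub>v unit_vec n j) = unit_vec n j"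
      proof -
        let ?u = "unit_vec n j :: real vec"
        define p where "p = H *\<^sub>v ?u"
        have p: "p = ?u - (c * (w \<bullet> ?u)) \<cdot>\<^sub>v w" unfolding p_def by (rule Happ) simp
        have pc: "p \<in> carrier_vec n" using w by (simp add: p)
        have "w \<bullet> p = w \<bullet> ?u - c * (w \<bullet> ?u) * (w \<bullet> w)"
          unfolding p using w by (subst scalar_prod_minus_distrib[of _ n]) auto
        then have "c * (w \<bullet> p) = - (c * (w \<bullet> ?u))"
          using wne by (simp add: c_def field_simps)
        then have "H *\<^sub>v p = ?u" unfolding Happ[OF pc] unfolding p using w
          by (intro eq_vecI) auto
        then show ?thesis by (simp add: p_def)
      qed
      then show "col (H * H) j = col (1\<^sub>m n) j" 
        using j unfolding col_mult2[OF H H j] colH by simp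
    qed (simp_all add: carrier_matD[OF H])
    have "w \<bullet> e = v $ 0 - 1"
      using v n unfolding w_def by (simp add: minus_scalar_prod_distrib[of _ n] e_def)
    then have "2 * (w \<bullet> e) = - (w \<bullet> w)" using ww by simp
    then have "c * (w \<bullet> e) = -1" using wne by (simp add: c_def field_simps)
    then show "H *\<^sub>v unit_vec n 0 = v"
      using Happ[OF e] v e unfolding w_def e_def[symmetric] by (intro eq_vecI) auto
  qed
qed

text \<open>The functional calculus of the orthonormal basis formed by the columns of \<open>U\<close>: if \<open>A\<close> is
\<open>spectral_mat n U d\<close>, then \<open>spectral_mat n U (\<lambda>i. f (d i))\<close> is what is usually written \<open>f(A)\<close>.\<close>

definition spectral_mat :: "nat \<Rightarrow> real mat \<Rightarrow> (nat \<Rightarrow> real) \<Rightarrow> real mat" where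
  "spectral_mat n U f = U * (mat_diag n f * U\<^sup>T)"

locale orthogonal_matrix =
  fixes n :: nat and U :: "real mat"
  assumes U_carrier: "U \<in> carrier_mat n n" and UtU: "U\<^sup>T * U = 1\<^sub>m n" and UUt: "U * U\<^sup>T = 1\<^sub>m n"

lemma dim_mat_diag [simp]: "dim_row (mat_diag n f) = n" "dim_col (mat_diag n f) = n"
  by (simp_all add: mat_diag_def)

lemma block_diag_mult:
  fixes A1 :: "'a::semiring_0 mat"
  assumes "A1 \<in> carrier_mat k k" "A2 \<in> carrier_mat k k" "D1 \<in> carrier_mat n n" "D2 \<in> carrier_mat n n"
  shows "four_block_mat A1 (0\<^sub>m k n) (0\<^sub>m n k) D1 * four_block_mat A2 (0\<^sub>m k n) (0\<^sub>m n k) D2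
    = four_block_mat (A1 * A2) (0\<^sub>m k n) (0\<^sub>m n k) (D1 * D2)"
proof -
  have d: "dim_row A1 = k" "dim_col A1 = k" "dim_row A2 = k" "dim_col A2 = k"
    "dim_row D1 = n" "dim_col D1 = n" "dim_row D2 = n" "dim_col D2 = n" using assms by auto
  have "A1 * A2 \<in> carrier_mat k k" "D1 * D2 \<in> carrier_mat n n" using assms by auto
  then show ?thesis
    by (subst mult_four_block_mat[OF assms(1) zero_carrier_mat zero_carrier_mat assms(3)
          assms(2) zero_carrier_mat zero_carrier_mat assms(4)])
      (simp add: d left_mult_zero_mat' right_mult_zero_mat' right_add_zero_mat left_add_zero_mat)
qed

text \<open>Conjugation by the reflection that takes \<open>e\<^sub>0\<close> to a unit eigenvector makes the first column a multiple
of \<open>e\<^sub>0\<close>; by symmetry the first row is too, and the induction hypothesis applies to the remaining block.\<close>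

theorem real_spectral_theorem:
  fixes A :: "real mat"
  assumes "A \<in> carrier_mat n n" and "A\<^sup>T = A"
  obtains U d where "orthogonal_matrix n U" "A = spectral_mat n U d"
proof -
  have "\<exists>U d. orthogonal_matrix n U \<and> A = spectral_mat n U d"
    using assms
  proof (induction n arbitrary: A)
    case 0
    have "orthogonal_matrix 0 (1\<^sub>m 0)" by unfold_locales auto
    moreover have "A = spectral_mat 0 (1\<^sub>m 0) (\<lambda>_. 0)"
      using 0 by (intro eq_matI) (auto simp: spectral_mat_def)
    ultimately show ?case by blast
  next
    case (Suc n)
    note A = Suc.prems(1) and sym = Suc.prems(2)
    obtain v a where v: "v \<in> carrier_vec (Suc n)" "v \<bullet> v = 1" and Av: "A *\<^sub>v v = a \<cdot>\<^sub>v v"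
      using symmetric_real_eigenvector[OF A sym] by auto
    obtain H where H: "H \<in> carrier_mat (Suc n) (Suc n)" and Ht: "H\<^sup>T = H"
      and HH: "H * H = 1\<^sub>m (Suc n)" and He: "H *\<^sub>v unit_vec (Suc n) 0 = v"
      using householder_reflection[OF v] by auto
    have dims: "dim_row A = Suc n" "dim_col A = Suc n" "dim_row H = Suc n" "dim_col H = Suc n"
      "dim_vec v = Suc n" using A H v by auto
    define A' where "A' = H * (A * H)"
    have A': "A' \<in> carrier_mat (Suc n) (Suc n)" using A H by (simp add: A'_def)
    have A't: "A'\<^sup>T = A'" by (simp add: A'_def transpose_mult_dim mult_assoc_dim dims Ht sym)
    let ?e = "unit_vec (Suc n) 0 :: real vec"
    have "H *\<^sub>v v = (H * H) *\<^sub>v ?e" by (simp add: mult_vec_assoc_dim dims He)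
    then have Hv: "H *\<^sub>v v = ?e" by (simp add: HH)
    have "A' *\<^sub>v ?e = a \<cdot>\<^sub>v ?e"
      by (simp add: A'_def mult_vec_assoc_dim dims He Av mult_mat_vec[OF H v(1)] Hv)
    then have "(A' *\<^sub>v ?e) $ i = (a \<cdot>\<^sub>v ?e) $ i" for i by simp
    then have col0: "A' $$ (i, 0) = (if i = 0 then a else 0)" if "i < Suc n" for i
    proof -
      have "row A' i \<in> carrier_vec (Suc n)" using A' that by auto
      then have "(A' *\<^sub>v ?e) $ i = row A' i $ 0"
        using carrier_matD[OF A'] that by simp
      then show ?thesis
        using \<open>(A' *\<^sub>v ?e) $ i = (a \<cdot>\<^sub>v ?e) $ i\<close> carrier_matD[OF A'] that by (simp split: if_splits)
    qed
    have row0: "A' $$ (0, i) = (if i = 0 then a else 0)" if "i < Suc n" for i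
    proof -
      have "A'\<^sup>T $$ (0, i) = A' $$ (i, 0)" using carrier_matD[OF A'] that by simp
      then show ?thesis using col0[OF that] by (simp add: A't)
    qed
    define A2 where "A2 = Matrix.mat n n (\<lambda>(i,j). A' $$ (Suc i, Suc j))"
    have A2: "A2 \<in> carrier_mat n n" by (simp add: A2_def)
    have A2t: "A2\<^sup>T = A2"
    proof (rule eq_matI)
      fix i j assume "i < dim_row A2" "j < dim_col A2"
      then have ij: "i < n" "j < n" by (auto simp: A2_def)
      have "A' $$ (Suc j, Suc i) = A'\<^sup>T $$ (Suc i, Suc j)" using A' ij by auto
      then show "A2\<^sup>T $$ (i, j) = A2 $$ (i, j)" using ij by (simp add: A2_def A't)
    qed (auto simp: A2_def)
    obtain V d where V: "orthogonal_matrix n V" and A2V: "A2 = spectral_mat n V d"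
      using Suc.IH[OF A2 A2t] by blast
    interpret V: orthogonal_matrix n V by (rule V)
    note Vc = V.U_carrier
    define D where "D = case_nat a d"
    define U2 where "U2 = four_block_mat (1\<^sub>m 1) (0\<^sub>m 1 n) (0\<^sub>m n 1) V"
    have U2: "U2 \<in> carrier_mat (Suc n) (Suc n)"
      using four_block_carrier_mat[OF one_carrier_mat[of 1] Vc] by (simp add: U2_def)
    have U2t: "U2\<^sup>T = four_block_mat (1\<^sub>m 1) (0\<^sub>m 1 n) (0\<^sub>m n 1) V\<^sup>T"
      unfolding U2_def by (subst transpose_four_block_mat[of _ 1 1 _ n _ n]) (use Vc in auto)
    have Dblock: "mat_diag (Suc n) D
        = four_block_mat (mat_diag 1 (\<lambda>_. a)) (0\<^sub>m 1 n) (0\<^sub>m n 1) (mat_diag n d)"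
      by (rule eq_matI) (auto simp: mat_diag_def D_def split: nat.split)
    have "mat_diag (Suc n) D * U2\<^sup>T
        = four_block_mat (mat_diag 1 (\<lambda>_. a)) (0\<^sub>m 1 n) (0\<^sub>m n 1) (mat_diag n d * V\<^sup>T)"
      unfolding Dblock U2t using Vc by (subst block_diag_mult) simp_all
    then have "U2 * (mat_diag (Suc n) D * U2\<^sup>T)
        = four_block_mat (1\<^sub>m 1) (0\<^sub>m 1 n) (0\<^sub>m n 1) V
          * four_block_mat (mat_diag 1 (\<lambda>_. a)) (0\<^sub>m 1 n) (0\<^sub>m n 1) (mat_diag n d * V\<^sup>T)"
      unfolding U2_def by (rule arg_cong)
    also have "\<dots> = four_block_mat (mat_diag 1 (\<lambda>_. a)) (0\<^sub>m 1 n) (0\<^sub>m n 1) A2"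
      unfolding A2V spectral_mat_def using Vc
      by (subst block_diag_mult) (simp_all add: left_mult_one_mat' mult_carrier_mat[of _ n n _ n])
    also have "\<dots> = A'"
    proof (rule eq_matI)
      fix i j assume "i < dim_row A'" "j < dim_col A'"
      then have ij: "i < Suc n" "j < Suc n" using A' by auto
      show "four_block_mat (mat_diag 1 (\<lambda>_. a)) (0\<^sub>m 1 n) (0\<^sub>m n 1) A2 $$ (i, j) = A' $$ (i, j)"
        using ij by (cases i; cases j) (simp_all add: A2_def mat_diag_def col0 row0)
    qed (use A' in \<open>simp_all add: A2_def mat_diag_def\<close>)
    finally have A'U2: "U2 * (mat_diag (Suc n) D * U2\<^sup>T) = A'" .
    have U2o: "U2\<^sup>T * U2 = 1\<^sub>m (Suc n)" "U2 * U2\<^sup>T = 1\<^sub>m (Suc n)"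
      unfolding U2t unfolding U2_def using Vc V.UtU V.UUt
      by (subst block_diag_mult, simp_all)+
    define U where "U = H * U2"
    have dims2: "dim_row U2 = Suc n" "dim_col U2 = Suc n" using U2 by auto
    have H_cancel: "H * (H * X) = X" if "dim_row X = Suc n" for X
    proof -
      have "H * (H * X) = (H * H) * X" using that by (simp add: mult_assoc_dim dims)
      then show ?thesis using that by (simp add: HH left_mult_one_mat')
    qed
    have U2_cancel: "U2 * (U2\<^sup>T * X) = X" if "dim_row X = Suc n" for X
    proof -
      have "U2 * (U2\<^sup>T * X) = (U2 * U2\<^sup>T) * X" using that by (simp add: mult_assoc_dim dims2)
      then show ?thesis using that by (simp add: U2o left_mult_one_mat')
    qed
    have "orthogonal_matrix (Suc n) U"
    proof
      show "U \<in> carrier_mat (Suc n) (Suc n)" using H U2 by (simp add: U_def)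
      show "U\<^sup>T * U = 1\<^sub>m (Suc n)"
        by (simp add: U_def transpose_mult_dim mult_assoc_dim dims dims2 Ht H_cancel U2o)
      show "U * U\<^sup>T = 1\<^sub>m (Suc n)"
        by (simp add: U_def transpose_mult_dim mult_assoc_dim dims dims2 Ht U2_cancel HH)
    qed
    moreover have "A = spectral_mat (Suc n) U D"
    proof -
      have "spectral_mat (Suc n) U D = H * ((U2 * (mat_diag (Suc n) D * U2\<^sup>T)) * H)"
        by (simp add: spectral_mat_def U_def transpose_mult_dim mult_assoc_dim dims dims2 Ht)
      also have "\<dots> = A"
        unfolding A'U2 by (simp add: A'_def mult_assoc_dim dims HH H_cancel right_mult_one_mat[OF A])
      finally show ?thesis ..
    qed
    ultimately show ?case by blast
  qed
  then show ?thesis using that by blast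
qed

context orthogonal_matrix
begin

lemma dim_U [simp]: "dim_row U = n" "dim_col U = n"
  using U_carrier by auto

lemma spectral_carrier [simp]: "spectral_mat n U f \<in> carrier_mat n n"
  using U_carrier by (auto simp: spectral_mat_def intro!: mult_carrier_mat[of _ n n _ n])

lemma spectral_dim [simp]: "dim_row (spectral_mat n U f) = n" "dim_col (spectral_mat n U f) = n"
  by (simp_all add: spectral_mat_def mat_diag_def)

text \<open>The entries are linear in the values \<open>f k\<close>. This gives linearity of the calculus and, later, turns
limits of the values into limits of the entries.\<close>

lemma spectral_index:
  assumes "i < n" "j < n"
  shows "spectral_mat n U f $$ (i, j) = (\<Sum>k<n. f k * (U $$ (i,k) * U $$ (j,k)))"
proof -
  have "mat_diag n f * U\<^sup>T = Matrix.mat n n (\<lambda>(k,j). f k * U $$ (j,k))"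
    by (subst mat_diag_mult_left[of _ n n]) (use U_carrier in \<open>auto intro!: eq_matI\<close>)
  then show ?thesis using assms
    by (simp add: spectral_mat_def scalar_prod_def atLeast0LessThan algebra_simps)
qed

lemma spectral_transpose [simp]: "(spectral_mat n U f)\<^sup>T = spectral_mat n U f"
  by (rule eq_matI) (auto simp: spectral_index mult.commute)

lemma spectral_mult: "spectral_mat n U f * spectral_mat n U g = spectral_mat n U (\<lambda>i. f i * g i)"
proof -
  have "U\<^sup>T * (U * X) = X" if "dim_row X = n" for X
  proof -
    have "U\<^sup>T * (U * X) = (U\<^sup>T * U) * X" using that by (simp add: mult_assoc_dim)
    then show ?thesis using that by (simp add: UtU left_mult_one_mat')
  qed
  moreover have "mat_diag n f * (mat_diag n g * U\<^sup>T) = mat_diag n (\<lambda>i. f i * g i) * U\<^sup>T"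
    by (simp flip: mult_assoc_dim mat_diag_diag)
  ultimately show ?thesis by (simp add: spectral_mat_def mult_assoc_dim)
qed

lemma spectral_one: "spectral_mat n U (\<lambda>_. 1) = 1\<^sub>m n"
  by (simp add: spectral_mat_def UUt left_mult_one_mat')

lemma spectral_quadratic_form:
  assumes v: "v \<in> carrier_vec n"
  shows "v \<bullet> (spectral_mat n U f *\<^sub>v v) = (\<Sum>k<n. f k * ((U\<^sup>T *\<^sub>v v) $ k)\<^sup>2)"
proof -
  define u where "u = U\<^sup>T *\<^sub>v v"
  have u: "dim_vec u = n" by (simp add: u_def)
  have "spectral_mat n U f *\<^sub>v v = U *\<^sub>v (mat_diag n f *\<^sub>v u)"
    using v by (simp add: spectral_mat_def mult_vec_assoc_dim mat_diag_def u_def)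
  then have "v \<bullet> (spectral_mat n U f *\<^sub>v v) = u \<bullet> (mat_diag n f *\<^sub>v u)"
    using v by (simp add: u_def scalar_prod_transpose_dim mat_diag_def)
  also have "mat_diag n f *\<^sub>v u = Matrix.vec n (\<lambda>k. f k * u $ k)"
  proof (rule eq_vecI)
    fix i assume "i < dim_vec (Matrix.vec n (\<lambda>k. f k * u $ k))"
    then have i: "i < n" by simp
    have "(if i = j then x else 0) * y = (if i = j then x * y else 0)" for j and x y :: real
      by simp
    then show "(mat_diag n f *\<^sub>v u) $ i = Matrix.vec n (\<lambda>k. f k * u $ k) $ i"
      using i u by (simp add: mat_diag_def scalar_prod_def atLeast0LessThan)
  qed (simp add: mat_diag_def)
  also have "u \<bullet> Matrix.vec n (\<lambda>k. f k * u $ k) = (\<Sum>k<n. f k * (u $ k)\<^sup>2)"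
    by (simp add: scalar_prod_def atLeast0LessThan power2_eq_square algebra_simps)
  finally show ?thesis by (simp add: u_def)
qed

lemma norm_coordinates:
  assumes v: "v \<in> carrier_vec n"
  shows "v \<bullet> v = (\<Sum>k<n. ((U\<^sup>T *\<^sub>v v) $ k)\<^sup>2)"
  using spectral_quadratic_form[OF v, of "\<lambda>_. 1"] v by (simp add: spectral_one)

lemma spectral_mult_col:
  assumes k: "k < n"
  shows "spectral_mat n U f *\<^sub>v col U k = f k \<cdot>\<^sub>v col U k"
proof -
  have "U\<^sup>T *\<^sub>v col U k = col (U\<^sup>T * U) k"
    by (rule col_mult2[symmetric, of _ n n _ n]) (use U_carrier k in auto)
  then have e: "U\<^sup>T *\<^sub>v col U k = unit_vec n k" using k by (simp add: UtU)
  have "mat_diag n f *\<^sub>v unit_vec n k = f k \<cdot>\<^sub>v unit_vec n k"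
    using k by (intro eq_vecI) (auto simp: mat_diag_def)
  moreover have "U *\<^sub>v unit_vec n k = col U k"
    using k by (intro eq_vecI) auto
  ultimately show ?thesis
    by (simp add: spectral_mat_def mult_vec_assoc_dim e mult_mat_vec[OF U_carrier])
qed

lemma spectral_eigenvalue:
  assumes k: "k < n"
  shows "eigenvalue (spectral_mat n U f) (f k)"
proof -
  have c: "col U k \<in> carrier_vec n" by (rule carrier_vecI) simp
  have "(U\<^sup>T * U) $$ (k,k) = 1" using k by (simp add: UtU)
  then have "col U k \<bullet> col U k = 1" using k by simp
  then have "col U k \<noteq> 0\<^sub>v n" by auto
  then show ?thesis using c spectral_mult_col[OF k]
    by (auto simp: eigenvalue_def eigenvector_def)
qed

end

lemma (in orthogonal_matrix) col_unit:
  assumes "k < n" shows "col U k \<bullet> col U k = 1"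
proof -
  have "(U\<^sup>T * U) $$ (k,k) = 1" using assms by (simp add: UtU)
  then show ?thesis using assms by simp
qed

text \<open>A sign condition on the quadratic form of a matrix thus passes to its eigenvalues.\<close>

lemma (in orthogonal_matrix) spectral_value_as_quadratic_form:
  assumes k: "k < n"
  shows "f k = col U k \<bullet> (spectral_mat n U f *\<^sub>v col U k)"
proof -
  have c: "col U k \<in> carrier_vec n" by (rule carrier_vecI) simp
  show ?thesis using c by (simp add: spectral_mult_col[OF k] col_unit[OF k])
qed

section \<open>Pseudoinverse, square root and whitening\<close>

lemma transpose_mult_self_eq_0:
  fixes E :: "real mat"
  assumes "E \<in> carrier_mat n m" "E\<^sup>T * E = 0\<^sub>m m m"
  shows "E = 0\<^sub>m n m"
proof (rule eq_matI)
  fix i j assume "i < dim_row (0\<^sub>m n m)" "j < dim_col (0\<^sub>m n m)"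
  then have ij: "i < n" "j < m" by auto
  have "(E\<^sup>T * E) $$ (j, j) = 0" using ij assms by simp
  then have "col E j \<bullet> col E j = 0" using ij assms(1) by simp
  moreover have "col E j \<in> carrier_vec n" using assms(1) by (intro carrier_vecI) simp
  ultimately have "col E j = 0\<^sub>v n" by (simp add: scalar_prod_self_eq_0)
  then have "col E j $ i = 0" using ij by simp
  then show "E $$ (i, j) = 0\<^sub>m n m $$ (i, j)" using ij assms(1) by simp
qed (use assms in auto)

text \<open>\<open>M X\<close> and \<open>M Y\<close> are symmetric, and each absorbs the other from one side, so transposing shows that they
are equal; likewise \<open>X M = Y M\<close>. Then \<open>X = X M X = X M Y = Y M Y = Y\<close>.\<close>

lemma moore_penrose_unique:
  assumes X: "is_moore_penrose M X" and Y: "is_moore_penrose M Y"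
  shows "X = Y"
proof -
  have d: "dim_row X = dim_col M" "dim_col X = dim_row M" "dim_row Y = dim_col M" "dim_col Y = dim_row M"
    using X Y by (auto simp: is_moore_penrose_def)
  note s = mult_assoc_dim transpose_mult_dim d
  have x: "M * (X * M) = M" "X * (M * X) = X" "(M * X)\<^sup>T = M * X" "(X * M)\<^sup>T = X * M"
    using X by (simp_all add: is_moore_penrose_def mult_assoc_dim d)
  have y: "M * (Y * M) = M" "Y * (M * Y) = Y" "(M * Y)\<^sup>T = M * Y" "(Y * M)\<^sup>T = Y * M"
    using Y by (simp_all add: is_moore_penrose_def mult_assoc_dim d)
  have "M * X = (M * (Y * M)) * X" by (simp add: y)
  also have "\<dots> = (M * Y) * (M * X)" by (simp add: mult_assoc_dim d)
  finally have 1: "M * X = (M * Y) * (M * X)" .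
  have "M * X = ((M * Y) * (M * X))\<^sup>T" using 1 x(3) by simp
  also have "\<dots> = (M * X) * (M * Y)" using x(3) y(3) by (simp only: transpose_mult_dim index_mult_mat d)
  also have "\<dots> = (M * (X * M)) * Y" by (simp add: mult_assoc_dim d)
  finally have E: "M * X = M * Y" by (simp add: x)
  have "X * M = X * (M * (Y * M))" by (simp add: y)
  also have "\<dots> = (X * M) * (Y * M)" by (simp add: mult_assoc_dim d)
  finally have 2: "X * M = (X * M) * (Y * M)" .
  have "X * M = ((X * M) * (Y * M))\<^sup>T" using 2 x(4) by simp
  also have "\<dots> = (Y * M) * (X * M)" using x(4) y(4) by (simp only: transpose_mult_dim index_mult_mat d)
  also have "\<dots> = Y * (M * (X * M))" by (simp add: mult_assoc_dim d)
  finally have F: "X * M = Y * M" by (simp add: x)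
  have "X = X * (M * Y)" using x(2) E by simp
  also have "\<dots> = (X * M) * Y" by (simp add: mult_assoc_dim d)
  also have "\<dots> = Y * (M * Y)" unfolding F by (simp add: mult_assoc_dim d)
  finally show ?thesis by (simp add: y)
qed

text \<open>The pseudoinverse inverts the nonzero eigenvalues and keeps the others, because \<open>inverse 0 = 0\<close> in
the field of real numbers. In particular it is symmetric and commutes with \<open>M\<close>.\<close>

lemma pinv_symmetric:
  assumes M: "M \<in> carrier_mat q q" and sym: "M\<^sup>T = M"
  shows "pinv M \<in> carrier_mat q q" "(pinv M)\<^sup>T = pinv M" "M * (pinv M * M) = M"
    "pinv M * (M * pinv M) = pinv M" "M * pinv M = pinv M * M"
proof -
  obtain U d where U: "orthogonal_matrix q U" and Md: "M = spectral_mat q U d"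
    using real_spectral_theorem[OF M sym] .
  interpret orthogonal_matrix q U by (rule U)
  define X where "X = spectral_mat q U (\<lambda>i. inverse (d i))"
  have eq: "(\<lambda>i. d i * (inverse (d i) * d i)) = d" "(\<lambda>i. d i * inverse (d i) * d i) = d"
    "(\<lambda>i. inverse (d i) * (d i * inverse (d i))) = (\<lambda>i. inverse (d i))"
    "(\<lambda>i. inverse (d i) * d i * inverse (d i)) = (\<lambda>i. inverse (d i))"
    by (auto simp: fun_eq_iff divide_simps)
  have "is_moore_penrose M X"
    by (simp add: is_moore_penrose_def Md X_def spectral_mult eq)
  then have "pinv M = X" unfolding pinv_def
    using moore_penrose_unique by (intro the_equality) auto
  then show "pinv M \<in> carrier_mat q q" "(pinv M)\<^sup>T = pinv M" "M * (pinv M * M) = M"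
    "pinv M * (M * pinv M) = pinv M" "M * pinv M = pinv M * M"
    by (simp_all add: Md X_def spectral_mult eq)
      (simp add: mult.commute)
qed

text \<open>Let \<open>v\<close> be a unit eigenvector of \<open>R - S\<close> with eigenvalue \<open>d\<close>. Then
\<open>d v \<bullet> (R + S) v = |R v|\<^sup>2 - |S v|\<^sup>2 = 0\<close>. If \<open>d\<close> were nonzero, the two nonnegative
numbers \<open>v \<bullet> R v\<close> and \<open>v \<bullet> S v\<close> would vanish, and so would their difference \<open>d\<close>. Hence all eigenvalues of
\<open>R - S\<close> are zero.\<close>

lemma psd_sqrt_unique:
  assumes R: "R \<in> carrier_mat n n" "sym_pos_semidef R" and S: "S \<in> carrier_mat n n" "sym_pos_semidef S"
    and eq: "R * R = S * S"
  shows "R = S"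
proof -
  have dim: "dim_row R = n" "dim_col R = n" "dim_row S = n" "dim_col S = n" using R S by auto
  have Rt: "R\<^sup>T = R" and St: "S\<^sup>T = S" using R S by (auto simp: sym_pos_semidef_def)
  define D where "D = R - S"
  have D: "D \<in> carrier_mat n n" using R S by (auto simp: D_def)
  have "D\<^sup>T = D" using transpose_minus[OF R(1) S(1)] by (simp add: D_def Rt St)
  with D obtain U d where U: "orthogonal_matrix n U" and Dd: "D = spectral_mat n U d"
    by (rule real_spectral_theorem)
  interpret orthogonal_matrix n U by (rule U)
  have "d k = 0" if k: "k < n" for k
  proof (rule ccontr)
    assume nz: "d k \<noteq> 0"
    define v where "v = col U k"
    have v: "v \<in> carrier_vec n" by (rule carrier_vecI) (simp add: v_def)
    have Rv: "R *\<^sub>v v \<in> carrier_vec n" and Sv: "S *\<^sub>v v \<in> carrier_vec n" using R S v by auto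
    have "d k \<cdot>\<^sub>v v = R *\<^sub>v v - S *\<^sub>v v"
      using spectral_mult_col[OF k, of d] R S v unfolding v_def[symmetric] Dd[symmetric] D_def
      by (simp add: minus_mult_distrib_mat_vec)
    then have dv: "d k \<cdot>\<^sub>v v = R *\<^sub>v v - S *\<^sub>v v" .
    have sq: "(M *\<^sub>v v) \<bullet> (M *\<^sub>v v) = v \<bullet> (M * M *\<^sub>v v)" if "M \<in> carrier_mat n n" "M\<^sup>T = M" for M
      using scalar_prod_transpose_dim[of v M "M *\<^sub>v v"] that v
      by (simp add: mult_vec_assoc_dim)
    have "(d k \<cdot>\<^sub>v v) \<bullet> (R *\<^sub>v v + S *\<^sub>v v) = (R *\<^sub>v v) \<bullet> (R *\<^sub>v v) - (S *\<^sub>v v) \<bullet> (S *\<^sub>v v)"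
      unfolding dv using Rv Sv
      by (simp add: minus_scalar_prod_distrib[of _ n] scalar_prod_add_distrib[of _ n]
          scalar_prod_commute_dim[of "R *\<^sub>v v" "S *\<^sub>v v"] dim)
    also have "\<dots> = 0" using sq[OF R(1) Rt] sq[OF S(1) St] eq by simp
    finally have "d k * (v \<bullet> (R *\<^sub>v v) + v \<bullet> (S *\<^sub>v v)) = 0"
      using v Rv Sv by (simp add: scalar_prod_add_distrib[of _ n] distrib_left)
    then have "v \<bullet> (R *\<^sub>v v) + v \<bullet> (S *\<^sub>v v) = 0" using nz by simp
    moreover have "v \<bullet> (R *\<^sub>v v) \<ge> 0" "v \<bullet> (S *\<^sub>v v) \<ge> 0"
      using R S v by (auto simp: sym_pos_semidef_def)
    ultimately have "v \<bullet> (R *\<^sub>v v) = 0" "v \<bullet> (S *\<^sub>v v) = 0" by linarith+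
    then have "v \<bullet> (d k \<cdot>\<^sub>v v) = 0"
      unfolding dv using v Rv Sv by (simp add: scalar_prod_minus_distrib[of _ n])
    then show False using nz v col_unit[OF k] by (simp add: v_def)
  qed
  then have "D $$ (i, j) = 0" if "i < n" "j < n" for i j
    using that by (simp add: Dd spectral_index)
  then have "R $$ (i, j) = S $$ (i, j)" if "i < n" "j < n" for i j
    using that dim by (auto simp: D_def)
  then show ?thesis using dim by (intro eq_matI) auto
qed

lemma mat_sqrt_eqI:
  assumes M: "M \<in> carrier_mat n n" and R: "R \<in> carrier_mat n n" "sym_pos_semidef R" and sq: "R * R = M"
  shows "mat_sqrt M = R"
  unfolding mat_sqrt_def
proof (rule the_equality)
  show "R \<in> carrier_mat (dim_row M) (dim_row M) \<and> sym_pos_semidef R \<and> R * R = M"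
    using assms by auto
next
  fix S assume "S \<in> carrier_mat (dim_row M) (dim_row M) \<and> sym_pos_semidef S \<and> S * S = M"
  then show "S = R" using psd_sqrt_unique[of S n R] assms by auto
qed

lemma mat_inv_eqI:
  assumes B: "B \<in> carrier_mat n n" and X: "X \<in> carrier_mat n n" and BX: "B * X = 1\<^sub>m n"
  shows "mat_inv B = X"
proof -
  have XB: "X * B = 1\<^sub>m n" by (rule mat_mult_left_right_inverse[OF B X BX])
  have "B \<in> Units (ring_mat TYPE(real) n ())"
    unfolding Units_def using B X BX XB by (auto simp: ring_mat_simps)
  then have "mat_inverse B \<noteq> None" using mat_inverse(1)[OF B, of "()"] by blast
  then obtain Y where Y: "mat_inverse B = Some Y" by blast
  have Y': "B * Y = 1\<^sub>m n" "Y * B = 1\<^sub>m n" "Y \<in> carrier_mat n n" using mat_inverse(2)[OF B Y] by auto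
  have "Y = Y * (B * X)" using Y' by (simp add: BX)
  also have "\<dots> = (Y * B) * X" by (rule assoc_mult_mat[symmetric, OF Y'(3) B X])
  also have "\<dots> = X" unfolding Y'(2) using X by simp
  finally show ?thesis by (simp add: mat_inv_def Y)
qed

lemma pos_def_whitening:
  assumes B: "B \<in> carrier_mat n n" and pd: "sym_pos_def B"
  obtains R Ri where "R \<in> carrier_mat n n" "Ri \<in> carrier_mat n n" "R\<^sup>T = R" "Ri\<^sup>T = Ri"
    "R * Ri = 1\<^sub>m n" "Ri * R = 1\<^sub>m n" "mat_inv B = R * R" "B = Ri * Ri" "mat_sqrt (mat_inv B) = R"
proof -
  have "B\<^sup>T = B" using pd by (simp add: sym_pos_def_def)
  with B obtain U d where U: "orthogonal_matrix n U" and Bd: "B = spectral_mat n U d"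
    by (rule real_spectral_theorem)
  interpret orthogonal_matrix n U by (rule U)
  have pos: "d k > 0" if k: "k < n" for k
  proof -
    have c: "col U k \<in> carrier_vec n" by (rule carrier_vecI) simp
    have "col U k \<noteq> 0\<^sub>v n" using col_unit[OF k] by auto
    then have "col U k \<bullet> (B *\<^sub>v col U k) > 0" using pd c B by (simp add: sym_pos_def_def)
    then show ?thesis unfolding Bd spectral_value_as_quadratic_form[OF k, symmetric] .
  qed
  have cong: "spectral_mat n U f = spectral_mat n U g" if "\<And>k. k < n \<Longrightarrow> f k = g k" for f g
    by (rule eq_matI) (simp_all add: spectral_index that)
  define R where "R = spectral_mat n U (\<lambda>k. 1 / sqrt (d k))"
  define Ri where "Ri = spectral_mat n U (\<lambda>k. sqrt (d k))"
  have one: "R * Ri = 1\<^sub>m n" "Ri * R = 1\<^sub>m n"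
    unfolding R_def Ri_def spectral_mult spectral_one[symmetric]
    by (rule cong, use pos in force)+
  have B2: "B = Ri * Ri"
    unfolding R_def Ri_def spectral_mult Bd by (rule cong) (use pos in \<open>force simp: less_imp_le\<close>)
  have RR: "mat_inv B = R * R"
  proof (rule mat_inv_eqI[OF B])
    show "R * R \<in> carrier_mat n n" by (simp add: R_def spectral_mult)
    show "B * (R * R) = 1\<^sub>m n"
      unfolding R_def Bd spectral_mult spectral_one[symmetric]
    proof (rule cong)
      fix k assume "k < n"
      then show "d k * (1 / sqrt (d k) * (1 / sqrt (d k))) = 1" using pos[of k] by simp
    qed
  qed
  have psd: "sym_pos_semidef R"
    using pos by (simp add: sym_pos_semidef_def R_def spectral_quadratic_form)
      (fastforce intro!: sum_nonneg divide_nonneg_nonneg simp: less_imp_le)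
  have "mat_sqrt (mat_inv B) = R"
    by (rule mat_sqrt_eqI[of _ n, OF _ _ psd]) (simp_all add: RR, simp_all add: R_def spectral_mult)
  with one B2 RR show ?thesis
    by (intro that[of R Ri]) (simp_all add: R_def Ri_def)
qed

text \<open>An orthogonal projection is determined by its range. The two hypotheses that link \<open>P\<close> to the symmetric matrix say that both have the
same range; two symmetric matrices that each fix the range of the other coincide.\<close>

lemma projection_onto_spectral_support:
  assumes U: "orthogonal_matrix n U" and P: "P \<in> carrier_mat n n" "P\<^sup>T = P"
    and Y: "Y \<in> carrier_mat n n"
    and PN: "P * spectral_mat n U d = spectral_mat n U d" and NY: "P = spectral_mat n U d * Y"
  shows "P = spectral_mat n U (\<lambda>k. if d k = 0 then 0 else 1)"
proof -
  interpret orthogonal_matrix n U by (rule U)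
  define Q where "Q = spectral_mat n U (\<lambda>k. if d k = 0 then 0 else 1)"
  have Qt: "Q\<^sup>T = Q" by (simp add: Q_def)
  have Q: "dim_row Q = n" "dim_col Q = n" by (simp_all add: Q_def)
  have e: "(\<lambda>i. (if d i = 0 then 0 else 1) * d i) = d" "(\<lambda>i. d i * inverse (d i)) = (\<lambda>k. if d k = 0 then 0 else 1)"
    by (auto simp: fun_eq_iff)
  have QN: "Q * spectral_mat n U d = spectral_mat n U d" unfolding Q_def spectral_mult e ..
  have "Q * P = (Q * spectral_mat n U d) * Y" using Y Q unfolding NY by (simp add: mult_assoc_dim)
  then have QP: "Q * P = P" by (simp add: QN NY)
  have NX: "Q = spectral_mat n U d * spectral_mat n U (\<lambda>i. inverse (d i))"
    unfolding Q_def spectral_mult e ..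
  have "P * Q = (P * spectral_mat n U d) * spectral_mat n U (\<lambda>i. inverse (d i))"
    using P(1) unfolding NX by (simp add: mult_assoc_dim)
  then have PQ: "P * Q = Q" by (simp add: PN NX)
  have "P = (Q * P)\<^sup>T" by (simp add: QP P)
  also have "\<dots> = P * Q" using P Q by (simp add: transpose_mult_dim Qt)
  finally have "P = Q" unfolding PQ .
  then show ?thesis unfolding Q_def .
qed

text \<open>On an eigenvector of \<open>N\<close> with eigenvalue \<open>d\<close> the iterated matrix acts as \<open>(1 - c d)\<^sup>k\<close>. The factor \<open>c\<close> is below the
reciprocal of the trace, hence \<open>0 \<le> c d < 1\<close>, and the limit is 1 for \<open>d = 0\<close> and 0 otherwise. So the iteration converges to
the projection onto the kernel of \<open>N\<close>, the complement of \<open>P\<close>. All its terms are measurable in \<open>N\<close>, with no matrix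
inversion involved.\<close>

lemma landweber_limit:
  fixes N :: "real mat"
  assumes N: "N \<in> carrier_mat n n" "N\<^sup>T = N" and psd: "\<And>v. v \<in> carrier_vec n \<Longrightarrow> v \<bullet> (N *\<^sub>v v) \<ge> 0"
    and P: "P \<in> carrier_mat n n" "P\<^sup>T = P" and Y: "Y \<in> carrier_mat n n"
    and PN: "P * N = N" and NY: "P = N * Y" and ij: "i < n" "j < n"
  defines "c \<equiv> 1 / (1 + (\<Sum>i<n. N $$ (i,i)))"
  shows "(\<lambda>k. ((1\<^sub>m n - c \<cdot>\<^sub>m N) ^\<^sub>m k) $$ (i,j)) \<longlonglongrightarrow> (1\<^sub>m n - P) $$ (i,j)"
proof -
  obtain U d where U: "orthogonal_matrix n U" and Nd: "N = spectral_mat n U d"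
    using real_spectral_theorem[OF N] .
  interpret orthogonal_matrix n U by (rule U)
  have nonneg: "d k \<ge> 0" if k: "k < n" for k
  proof -
    have "col U k \<in> carrier_vec n" by (rule carrier_vecI) simp
    from psd[OF this] show ?thesis unfolding Nd spectral_value_as_quadratic_form[OF k, symmetric] .
  qed
  \<comment> \<open>the trace is the sum of the eigenvalues\<close>
  have "(\<Sum>i<n. N $$ (i,i)) = (\<Sum>k<n. d k * (\<Sum>i<n. U $$ (i,k) * U $$ (i,k)))"
    by (simp add: Nd spectral_index sum_distrib_left) (rule sum.swap)
  also have "\<dots> = (\<Sum>k<n. d k)"
  proof (rule sum.cong[OF refl])
    fix k assume "k \<in> {..<n}"
    then have k: "k < n" by simp
    have "(\<Sum>i<n. U $$ (i,k) * U $$ (i,k)) = col U k \<bullet> col U k"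
      using k by (simp add: scalar_prod_def atLeast0LessThan)
    then show "d k * (\<Sum>i<n. U $$ (i,k) * U $$ (i,k)) = d k" by (simp add: col_unit[OF k])
  qed
  finally have c: "c = 1 / (1 + (\<Sum>k<n. d k))" by (simp add: c_def)
  have s0: "(\<Sum>k<n. d k) \<ge> 0" using nonneg by (intro sum_nonneg) auto
  have lin: "spectral_mat n U (\<lambda>k. 1 - a * f k) = 1\<^sub>m n - a \<cdot>\<^sub>m spectral_mat n U f" for a f
    unfolding spectral_one[symmetric]
    by (rule eq_matI) (auto simp: spectral_index sum_subtractf[symmetric] sum_distrib_left left_diff_distrib
        mult.assoc intro!: sum.cong)
  have pow: "(1\<^sub>m n - c \<cdot>\<^sub>m N) ^\<^sub>m k = spectral_mat n U (\<lambda>l. (1 - c * d l) ^ k)" for k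
  proof (induction k)
    case 0
    then show ?case by (simp add: spectral_one Nd)
  next
    case (Suc k)
    have "(1\<^sub>m n - c \<cdot>\<^sub>m N) ^\<^sub>m Suc k = spectral_mat n U (\<lambda>l. (1 - c * d l) ^ k) * (1\<^sub>m n - c \<cdot>\<^sub>m N)"
      by (simp add: Suc.IH)
    then show ?case by (simp add: Nd lin[symmetric] spectral_mult mult.commute)
  qed
  have PQ: "P = spectral_mat n U (\<lambda>k. if d k = 0 then 0 else 1)"
    using projection_onto_spectral_support[OF U P Y] PN NY by (simp add: Nd)
  have "1\<^sub>m n - P = spectral_mat n U (\<lambda>k. 1 - 1 * (if d k = 0 then 0 else 1))"
    unfolding lin PQ by (rule arg_cong, rule eq_matI) simp_all
  then have lim: "1\<^sub>m n - P = spectral_mat n U (\<lambda>k. if d k = 0 then 1 else 0)"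
    by (simp add: if_distrib cong: if_cong)
  have conv: "(\<lambda>k. (1 - c * d l) ^ k) \<longlonglongrightarrow> (if d l = 0 then 1 else 0)" if l: "l < n" for l
  proof (cases "d l = 0")
    case False
    then have dl: "d l > 0" using nonneg[OF l] by simp
    have "d l \<le> (\<Sum>k<n. d k)" using nonneg l by (intro member_le_sum) auto
    then have "c * d l \<le> 1" "c * d l > 0" using s0 dl by (auto simp: c field_simps)
    then have "norm (1 - c * d l) < 1" by simp
    from LIMSEQ_power_zero[OF this] show ?thesis using False by simp
  qed simp
  show ?thesis unfolding pow lim spectral_index[OF ij]
    by (intro tendsto_sum tendsto_mult conv tendsto_const) simp
qed

section \<open>Measurability of matrix-valued functions\<close>

definition measurable_mat :: "'w measure \<Rightarrow> nat \<Rightarrow> nat \<Rightarrow> ('w \<Rightarrow> real mat) \<Rightarrow> bool" where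
  "measurable_mat M r c F \<longleftrightarrow> (\<forall>w\<in>space M. F w \<in> carrier_mat r c) \<and>
     (\<forall>i<r. \<forall>j<c. (\<lambda>w. F w $$ (i, j)) \<in> borel_measurable M)"

lemma measurable_matI:
  assumes "\<And>w. w \<in> space M \<Longrightarrow> F w \<in> carrier_mat r c"
    and "\<And>i j. i < r \<Longrightarrow> j < c \<Longrightarrow> (\<lambda>w. F w $$ (i, j)) \<in> borel_measurable M"
  shows "measurable_mat M r c F"
  using assms by (auto simp: measurable_mat_def)

lemma measurable_matD:
  assumes "measurable_mat M r c F"
  shows "w \<in> space M \<Longrightarrow> F w \<in> carrier_mat r c"
    and "i < r \<Longrightarrow> j < c \<Longrightarrow> (\<lambda>w. F w $$ (i, j)) \<in> borel_measurable M"
  using assms by (auto simp: measurable_mat_def)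

lemma measurable_mat_const: "C \<in> carrier_mat r c \<Longrightarrow> measurable_mat M r c (\<lambda>_. C)"
  by (auto simp: measurable_mat_def)

lemma mult_mat_index_sum:
  assumes "A \<in> carrier_mat r k" "B \<in> carrier_mat k c" "i < r" "j < c"
  shows "(A * B) $$ (i, j) = (\<Sum>l<k. A $$ (i, l) * B $$ (l, j))"
  using assms by (simp add: scalar_prod_def atLeast0LessThan)

lemma measurable_mat_mult:
  assumes F: "measurable_mat M r k F" and G: "measurable_mat M k c G"
  shows "measurable_mat M r c (\<lambda>w. F w * G w)"
proof (rule measurable_matI)
  show "F w * G w \<in> carrier_mat r c" if "w \<in> space M" for w
    using measurable_matD(1)[OF F that] measurable_matD(1)[OF G that] by simp
  fix i j assume ij: "i < r" "j < c"
  have "(\<lambda>w. \<Sum>l<k. F w $$ (i, l) * G w $$ (l, j)) \<in> borel_measurable M"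
    using measurable_matD(2)[OF F] measurable_matD(2)[OF G] ij
    by (intro borel_measurable_sum borel_measurable_times) auto
  moreover have "(F w * G w) $$ (i, j) = (\<Sum>l<k. F w $$ (i, l) * G w $$ (l, j))" if "w \<in> space M" for w
    by (rule mult_mat_index_sum[OF measurable_matD(1)[OF F that] measurable_matD(1)[OF G that] ij])
  ultimately show "(\<lambda>w. (F w * G w) $$ (i, j)) \<in> borel_measurable M"
    by (simp cong: measurable_cong del: index_mult_mat)
qed

lemma measurable_mat_minus:
  assumes F: "measurable_mat M r c F" and G: "measurable_mat M r c G"
  shows "measurable_mat M r c (\<lambda>w. F w - G w)"
proof (rule measurable_matI)
  show "F w - G w \<in> carrier_mat r c" if "w \<in> space M" for w
    using measurable_matD(1)[OF G that] by (rule minus_carrier_mat)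
  fix i j assume ij: "i < r" "j < c"
  have "(\<lambda>w. F w $$ (i, j) - G w $$ (i, j)) \<in> borel_measurable M"
    using measurable_matD(2)[OF F ij] measurable_matD(2)[OF G ij] by simp
  moreover have "(F w - G w) $$ (i, j) = F w $$ (i, j) - G w $$ (i, j)" if "w \<in> space M" for w
    using carrier_matD[OF measurable_matD(1)[OF G that]] ij by simp
  ultimately show "(\<lambda>w. (F w - G w) $$ (i, j)) \<in> borel_measurable M"
    by (simp cong: measurable_cong)
qed

lemma measurable_mat_smult:
  assumes F: "measurable_mat M r c F" and f: "f \<in> borel_measurable M"
  shows "measurable_mat M r c (\<lambda>w. f w \<cdot>\<^sub>m F w)"
proof (rule measurable_matI)
  show "f w \<cdot>\<^sub>m F w \<in> carrier_mat r c" if "w \<in> space M" for w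
    using measurable_matD(1)[OF F that] by simp
  fix i j assume ij: "i < r" "j < c"
  have "(\<lambda>w. f w * F w $$ (i, j)) \<in> borel_measurable M"
    using measurable_matD(2)[OF F ij] f by simp
  moreover have "(f w \<cdot>\<^sub>m F w) $$ (i, j) = f w * F w $$ (i, j)" if "w \<in> space M" for w
    using carrier_matD[OF measurable_matD(1)[OF F that]] ij by simp
  ultimately show "(\<lambda>w. (f w \<cdot>\<^sub>m F w) $$ (i, j)) \<in> borel_measurable M"
    by (simp cong: measurable_cong)
qed

lemma measurable_mat_pow:
  assumes F: "measurable_mat M r r F"
  shows "measurable_mat M r r (\<lambda>w. F w ^\<^sub>m k)"
proof (induction k)
  case 0
  have "(1\<^sub>m (dim_row (F w)) :: real mat) = 1\<^sub>m r" if "w \<in> space M" for w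
    using carrier_matD[OF measurable_matD(1)[OF F that]] by simp
  then have "measurable_mat M r r (\<lambda>w. 1\<^sub>m (dim_row (F w))) = measurable_mat M r r (\<lambda>w. 1\<^sub>m r)"
    unfolding measurable_mat_def by (simp cong: measurable_cong)
  then show ?case by (simp add: measurable_mat_const)
next
  case (Suc k)
  then show ?case using measurable_mat_mult[OF Suc F] by simp
qed

lemma space_mat_space: "space (mat_space m) = {S. dim_row S = m}"
  unfolding mat_space_def by (rule space_measure_of) auto

lemma sets_mat_space: "sets (mat_space m) = sigma_sets {S. dim_row S = m}
     (range (carrier_mat m) \<union>
      {{S \<in> carrier_mat m q. S $$ (i, j) \<le> c} | q i j c. i < m \<and> j < q})"
  unfolding mat_space_def by (rule sets_measure_of) auto

lemma carrier_in_mat_space: "carrier_mat m q \<in> sets (mat_space m)"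
  unfolding sets_mat_space by (rule sigma_sets.Basic) auto

lemma entry_halfspace_in_mat_space:
  "i < m \<Longrightarrow> j < q \<Longrightarrow> {S \<in> carrier_mat m q. S $$ (i, j) \<le> c} \<in> sets (mat_space m)"
  unfolding sets_mat_space by (rule sigma_sets.Basic) blast

text \<open>The number of columns is itself random, so a sum over the columns is measurable only because this number
takes countably many values.\<close>

lemma dim_col_measurable: "dim_col \<in> measurable (mat_space m) (count_space UNIV)"
proof -
  have "dim_col -` {q} \<inter> space (mat_space m) = carrier_mat m q" for q
    by (auto simp: space_mat_space)
  then show ?thesis
    by (subst measurable_count_space_eq_countable) (simp_all add: carrier_in_mat_space)
qed

lemma entry_measurable:
  assumes i: "i < m"
  shows "(\<lambda>S. if l < dim_col S then S $$ (i, l) else 0) \<in> borel_measurable (mat_space m)"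
  unfolding borel_measurable_iff_le
proof
  fix c :: real
  have "{S \<in> space (mat_space m). (if l < dim_col S then S $$ (i, l) else 0) \<le> c}
      = (\<Union>q. {S \<in> carrier_mat m q. (if l < q then S $$ (i, l) else 0) \<le> c})"
    by (auto simp: space_mat_space)
  also have "\<dots> \<in> sets (mat_space m)"
  proof (intro sets.countable_UN image_subsetI)
    fix q show "{S \<in> carrier_mat m q. (if l < q then S $$ (i, l) else 0) \<le> c} \<in> sets (mat_space m)"
      using entry_halfspace_in_mat_space[OF i, of l q c] carrier_in_mat_space[of m q]
      by (cases "l < q"; cases "0 \<le> c") simp_all
  qed
  finally show "{S \<in> space (mat_space m). (if l < dim_col S then S $$ (i, l) else 0) \<le> c} \<in> sets (mat_space m)" .
qed

lemma gram_measurable: "measurable_mat (mat_space m) m m (\<lambda>S. S * S\<^sup>T)"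
proof (rule measurable_matI)
  fix i j assume ij: "i < m" "j < m"
  define e where "e i l S = (if l < dim_col S then S $$ (i, l) else 0)" for i l and S :: "real mat"
  have e: "e i l \<in> borel_measurable (mat_space m)" if "i < m" for i l
    unfolding e_def by (rule entry_measurable[OF that])
  have "(\<lambda>S. (\<Sum>l<dim_col S. e i l S * e j l S)) \<in> borel_measurable (mat_space m)"
    using e[OF ij(1)] e[OF ij(2)]
    by (intro measurable_compose_countable[OF _ dim_col_measurable, of "\<lambda>q S. \<Sum>l<q. e i l S * e j l S"]
        borel_measurable_sum borel_measurable_times) auto
  moreover have "(S * S\<^sup>T) $$ (i, j) = (\<Sum>l<dim_col S. e i l S * e j l S)" if "S \<in> space (mat_space m)" for S
    using that ij by (simp add: space_mat_space e_def scalar_prod_def atLeast0LessThan)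
  ultimately show "(\<lambda>S. (S * S\<^sup>T) $$ (i, j)) \<in> borel_measurable (mat_space m)"
    by (simp cong: measurable_cong)
qed (auto simp: space_mat_space)

section \<open>The whitened sketch projection\<close>

lemma orth_projection_quadratic_form:
  fixes P :: "real mat"
  assumes P: "P \<in> carrier_mat n n" "P\<^sup>T = P" "P * P = P" and v: "v \<in> carrier_vec n"
  shows "v \<bullet> (P *\<^sub>v v) \<ge> 0" "v \<bullet> (P *\<^sub>v v) \<le> v \<bullet> v"
proof -
  define u where "u = P *\<^sub>v v"
  have u: "u \<in> carrier_vec n" using P v by (simp add: u_def)
  have "v \<bullet> (P *\<^sub>v v) = v \<bullet> (P *\<^sub>v u)"
    using P v unfolding u_def by (subst mult_vec_assoc_dim[symmetric]) simp_all
  then have eq: "v \<bullet> u = u \<bullet> u"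
    using scalar_prod_transpose_dim[of v P u] P v u by (simp add: u_def)
  then show "v \<bullet> (P *\<^sub>v v) \<ge> 0" using scalar_prod_self_nonneg[of u] by (simp add: u_def)
  have "(v - u) \<bullet> (v - u) = v \<bullet> v - v \<bullet> u"
    using u v eq by (simp add: minus_scalar_prod_distrib[of _ n] scalar_prod_minus_distrib[of _ n]
        scalar_prod_commute_dim[of u v])
  then show "v \<bullet> (P *\<^sub>v v) \<le> v \<bullet> v" using scalar_prod_self_nonneg[of "v - u"] by (simp add: u_def)
qed

text \<open>The diagonal entry is the squared norm of its row, \<open>P\<^sub>i\<^sub>i = \<Sum>\<^sub>l P\<^sub>i\<^sub>l\<^sup>2\<close>. So \<open>P\<^sub>i\<^sub>i\<^sup>2 \<le> P\<^sub>i\<^sub>i\<close>, which bounds \<open>P\<^sub>i\<^sub>i\<close> by 1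
and then every entry of the row.\<close>

lemma orth_projection_entry_bound:
  fixes P :: "real mat"
  assumes P: "P \<in> carrier_mat n n" "P\<^sup>T = P" "P * P = P" and ij: "i < n" "j < n"
  shows "\<bar>P $$ (i, j)\<bar> \<le> 1"
proof -
  have sym: "P $$ (l, i) = P $$ (i, l)" if "l < n" for l
    using P(1,2) ij(1) that by (metis carrier_matD index_transpose_mat(1))
  have "P $$ (i, i) = (\<Sum>l<n. P $$ (i, l) * P $$ (l, i))"
    using mult_mat_index_sum[OF P(1) P(1) ij(1) ij(1)] by (simp add: P(3))
  then have eq: "P $$ (i, i) = (\<Sum>l<n. (P $$ (i, l))\<^sup>2)" by (simp add: sym power2_eq_square)
  have le: "(P $$ (i, l))\<^sup>2 \<le> P $$ (i, i)" if "l < n" for l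
    unfolding eq using that by (intro member_le_sum) auto
  have "P $$ (i, i) \<ge> 0" unfolding eq by (intro sum_nonneg) simp
  moreover have "P $$ (i, i) * P $$ (i, i) \<le> P $$ (i, i)" using le[OF ij(1)] by (simp add: power2_eq_square)
  ultimately have "P $$ (i, i) \<le> 1"
    using mult_strict_left_mono[of 1 "P $$ (i, i)" "P $$ (i, i)"] by linarith
  then have "(P $$ (i, j))\<^sup>2 \<le> 1" using le[OF ij(2)] by linarith
  then show ?thesis by (simp add: abs_square_le_1)
qed

text \<open>\<open>R\<close> stands for the square root of the inverse of \<open>B\<close>, and \<open>Ri\<close> for the square root of \<open>B\<close>.\<close>

locale whitened_system =
  fixes m n :: nat and A B R Ri :: "real mat"
  assumes A: "A \<in> carrier_mat m n" and R: "R \<in> carrier_mat n n" and Ri: "Ri \<in> carrier_mat n n"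
    and Rt: "R\<^sup>T = R" and Rit: "Ri\<^sup>T = Ri" and RRi: "R * Ri = 1\<^sub>m n" and RiR: "Ri * R = 1\<^sub>m n"
    and inv_B: "mat_inv B = R * R" and B_eq: "B = Ri * Ri"
begin

lemma dims [simp]: "dim_row A = m" "dim_col A = n" "dim_row R = n" "dim_col R = n"
  "dim_row Ri = n" "dim_col Ri = n"
  using A R Ri by auto

lemma R_cancel:
  assumes "dim_row X = n"
  shows "R * (Ri * X) = X" "Ri * (R * X) = X"
  using assms mult_assoc_dim[of R Ri X] mult_assoc_dim[of Ri R X]
  by (simp_all add: RRi RiR left_mult_one_mat')

lemma R_cancel_vec:
  assumes "dim_vec v = n"
  shows "R *\<^sub>v (Ri *\<^sub>v v) = v" "Ri *\<^sub>v (R *\<^sub>v v) = v"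
proof -
  have v: "v \<in> carrier_vec n" using assms by (rule carrier_vecI)
  show "R *\<^sub>v (Ri *\<^sub>v v) = v" "Ri *\<^sub>v (R *\<^sub>v v) = v"
    using assms mult_vec_assoc_dim[of R Ri v] mult_vec_assoc_dim[of Ri R v]
    by (simp_all add: RRi RiR one_mult_mat_vec[OF v])
qed

definition sketch_proj :: "real mat \<Rightarrow> real mat" where
  "sketch_proj S = R * (Z_mat A B S * R)"

text \<open>This is \<open>K K\<^sup>T\<close> for \<open>K = R A\<^sup>T S\<close>. It depends on \<open>S\<close> only through the \<open>m \<times> m\<close> matrix \<open>S S\<^sup>T\<close>,
whose size does not vary with the number of columns of \<open>S\<close>.\<close>

definition sketch_gram :: "real mat \<Rightarrow> real mat" where
  "sketch_gram S = R * (A\<^sup>T * (S * S\<^sup>T * (A * R)))"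

text \<open>Put \<open>K = R A\<^sup>T S\<close> and \<open>M = K\<^sup>T K\<close>; then the matrix is \<open>K M\<^sup>+ K\<^sup>T\<close>, the classical formula for the
orthogonal projection onto the range of \<open>K\<close>. The last two conclusions give the factorizations through \<open>K K\<^sup>T\<close> and \<open>A\<^sup>T\<close>
that are needed for the limit formula and for the projection onto the solution set.\<close>

lemma sketch_proj_facts:
  assumes S: "dim_row S = m"
  shows "Z_mat A B S \<in> carrier_mat n n" "(Z_mat A B S)\<^sup>T = Z_mat A B S"
    "sketch_proj S \<in> carrier_mat n n" "(sketch_proj S)\<^sup>T = sketch_proj S"
    "sketch_proj S * sketch_proj S = sketch_proj S"
    "sketch_proj S * (R * (A\<^sup>T * S)) = R * (A\<^sup>T * S)"
    "sketch_proj S * sketch_gram S = sketch_gram S"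
    "\<exists>Y \<in> carrier_mat n n. sketch_proj S = sketch_gram S * Y"
    "\<exists>Y \<in> carrier_mat n m. Z_mat A B S = A\<^sup>T * (Y\<^sup>T)"
proof -
  define q where "q = dim_col S"
  define K where "K = R * (A\<^sup>T * S)"
  define M where "M = S\<^sup>T * A * mat_inv B * A\<^sup>T * S"
  define X where "X = pinv M"
  have dS: "dim_row S = m" "dim_col S = q" using S by (auto simp: q_def)
  have dK: "dim_row K = n" "dim_col K = q" by (simp_all add: K_def dS)
  have MK: "M = K\<^sup>T * K"
    by (simp add: M_def K_def inv_B mult_assoc_dim transpose_mult_dim dS Rt)
  have M: "M \<in> carrier_mat q q" by (rule carrier_matI) (simp_all add: MK dK)
  have Mt: "M\<^sup>T = M" by (simp add: MK transpose_mult_dim dK)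
  note px = pinv_symmetric[OF M Mt, folded X_def]
  have dX: "dim_row X = q" "dim_col X = q" using px(1) by auto
  have dM: "dim_row M = q" "dim_col M = q" using M by auto
  have Zeq: "Z_mat A B S = A\<^sup>T * (S * (X * (S\<^sup>T * A)))"
    by (simp add: Z_mat_def H_mat_def M_def[symmetric] X_def[symmetric] mult_assoc_dim dX dS)
  show Zc: "Z_mat A B S \<in> carrier_mat n n" by (rule carrier_matI) (simp_all add: Zeq)
  show Zt: "(Z_mat A B S)\<^sup>T = Z_mat A B S"
    by (simp add: Zeq transpose_mult_dim mult_assoc_dim dS dX px(2))
  have PK: "sketch_proj S = K * (X * K\<^sup>T)"
    by (simp add: sketch_proj_def Zeq K_def transpose_mult_dim mult_assoc_dim dS dX Rt)
  show "sketch_proj S \<in> carrier_mat n n" by (rule carrier_matI) (simp_all add: PK dK)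
  show "(sketch_proj S)\<^sup>T = sketch_proj S"
    by (simp add: PK transpose_mult_dim mult_assoc_dim dK dX px(2))
  have XM: "X * (K\<^sup>T * (K * W)) = X * (M * W)" if "dim_row W = q" for W
    using that by (simp add: MK mult_assoc_dim dK)
  have XMX: "X * (M * (X * W)) = X * W" if "dim_row W = q" for W
  proof -
    have "X * (M * (X * W)) = (X * (M * X)) * W" using that by (simp add: mult_assoc_dim dX dM)
    then show ?thesis unfolding px(4) .
  qed
  show "sketch_proj S * sketch_proj S = sketch_proj S"
    by (simp add: PK mult_assoc_dim dK dX XM XMX)
  define C where "C = X * M - 1\<^sub>m q"
  have C: "C \<in> carrier_mat q q" by (simp add: C_def minus_carrier_mat)
  have "M * C = M * (X * M) - M * 1\<^sub>m q"
    unfolding C_def by (rule mult_minus_distrib_mat[of _ q q _ q]) (use M px(1) in simp_all)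
  \<comment> \<open>\<open>M C = 0\<close> forces \<open>K C = 0\<close>, because \<open>(K C)\<^sup>T (K C) = C\<^sup>T (M C)\<close>\<close>
  then have MC: "M * C = 0\<^sub>m q q" using M by (simp add: px)
  have KC: "K * C \<in> carrier_mat n q" by (rule carrier_matI) (use C in \<open>simp_all add: dK\<close>)
  have "(K * C)\<^sup>T * (K * C) = C\<^sup>T * (M * C)"
    using carrier_matD[OF C] by (simp add: MK mult_assoc_dim transpose_mult_dim dK)
  also have "\<dots> = 0\<^sub>m q q" using C by (simp add: MC)
  finally have "K * C = 0\<^sub>m n q" by (rule transpose_mult_self_eq_0[OF KC])
  moreover have "K * C = K * (X * M) - K * 1\<^sub>m q"
    unfolding C_def by (rule mult_minus_distrib_mat[of _ n q _ q]) (use M px(1) dK in \<open>auto\<close>)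
  ultimately have "K * (X * M) - K = 0\<^sub>m n q" using dK by (simp add: right_mult_one_mat')
  then have KXM: "K * (X * M) = K"
    using dK dX dM by (auto simp: mat_eq_iff)
  show PKK: "sketch_proj S * (R * (A\<^sup>T * S)) = R * (A\<^sup>T * S)"
    unfolding K_def[symmetric] using KXM by (simp add: PK mult_assoc_dim dK dX MK)
  have N: "sketch_gram S = K * K\<^sup>T"
    by (simp add: sketch_gram_def K_def transpose_mult_dim mult_assoc_dim dS Rt)
  have dP: "dim_row (sketch_proj S) = n" "dim_col (sketch_proj S) = n" by (simp_all add: PK dK)
  show "sketch_proj S * sketch_gram S = sketch_gram S"
    using PKK unfolding K_def[symmetric] N by (simp add: dP dK flip: mult_assoc_dim)
  \<comment> \<open>moving \<open>M\<close> to the front uses that \<open>M\<close> commutes with its pseudoinverse\<close>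
  have "K * (X * K\<^sup>T) = K * ((X * (M * X)) * K\<^sup>T)" unfolding px(4) ..
  also have "\<dots> = K * (((X * M) * X) * K\<^sup>T)" by (simp add: mult_assoc_dim dX dM)
  also have "\<dots> = K * (((M * X) * X) * K\<^sup>T)" by (simp add: px(5))
  also have "\<dots> = sketch_gram S * (K * (X * (X * K\<^sup>T)))"
    by (simp add: N MK mult_assoc_dim dK dX)
  finally show "\<exists>Y \<in> carrier_mat n n. sketch_proj S = sketch_gram S * Y"
    unfolding PK by (intro bexI[of _ "K * (X * (X * K\<^sup>T))"] carrier_matI) (simp_all add: dK)
  show "\<exists>Y \<in> carrier_mat n m. Z_mat A B S = A\<^sup>T * (Y\<^sup>T)"
    by (rule bexI[of _ "(S * (X * (S\<^sup>T * A)))\<^sup>T"]) (auto simp: Zeq dS intro!: carrier_matI)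
qed

lemma Z_from_proj:
  assumes "dim_row S = m"
  shows "Z_mat A B S = Ri * (sketch_proj S * Ri)"
proof -
  have d: "dim_row (Z_mat A B S) = n" "dim_col (Z_mat A B S) = n"
    using sketch_proj_facts(1)[OF assms] by auto
  show ?thesis
    by (simp add: sketch_proj_def mult_assoc_dim R_cancel RRi right_mult_one_mat' d)
qed

lemma sketch_proj_measurable: "measurable_mat (mat_space m) n n sketch_proj"
proof (rule measurable_matI)
  show "sketch_proj S \<in> carrier_mat n n" if "S \<in> space (mat_space m)" for S
    using that by (simp add: space_mat_space sketch_proj_facts)
  fix i j assume ij: "i < n" "j < n"
  have G: "measurable_mat (mat_space m) n n sketch_gram"
    unfolding sketch_gram_def[abs_def]
    by (rule measurable_mat_mult[OF measurable_mat_const[OF R] measurable_mat_mult[OF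
          measurable_mat_const[OF transpose_carrier_mat[THEN iffD2, OF A]]
          measurable_mat_mult[OF gram_measurable measurable_mat_const[OF mult_carrier_mat[OF A R]]]]])
  let ?c = "\<lambda>S. 1 / (1 + (\<Sum>i<n. sketch_gram S $$ (i, i)))"
  have c: "?c \<in> borel_measurable (mat_space m)"
    by (intro borel_measurable_divide borel_measurable_const borel_measurable_add
        borel_measurable_sum measurable_matD(2)[OF G]) auto
  have L: "measurable_mat (mat_space m) n n (\<lambda>S. (1\<^sub>m n - ?c S \<cdot>\<^sub>m sketch_gram S) ^\<^sub>m k)" for k
    by (rule measurable_mat_pow[OF measurable_mat_minus[OF measurable_mat_const[OF one_carrier_mat]
          measurable_mat_smult[OF G c]]])
  have "(\<lambda>S. (1\<^sub>m n - sketch_proj S) $$ (i, j)) \<in> borel_measurable (mat_space m)"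
  proof (rule borel_measurable_LIMSEQ_real[OF _ measurable_matD(2)[OF L ij]])
    fix S assume "S \<in> space (mat_space m)"
    then have S: "dim_row S = m" by (simp add: space_mat_space)
    note f = sketch_proj_facts[OF S]
    obtain Y where Y: "Y \<in> carrier_mat n n" "sketch_proj S = sketch_gram S * Y" using f(8) by blast
    show "(\<lambda>k. ((1\<^sub>m n - ?c S \<cdot>\<^sub>m sketch_gram S) ^\<^sub>m k) $$ (i, j)) \<longlonglongrightarrow> (1\<^sub>m n - sketch_proj S) $$ (i, j)"
    proof (rule landweber_limit[OF _ _ _ f(3,4) Y(1) f(7) Y(2) ij])
      show "sketch_gram S \<in> carrier_mat n n" by (rule carrier_matI) (simp_all add: sketch_gram_def)
      show "(sketch_gram S)\<^sup>T = sketch_gram S"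
        by (simp add: sketch_gram_def transpose_mult_dim mult_assoc_dim S Rt)
      fix v :: "real vec" assume v: "v \<in> carrier_vec n"
      define u where "u = S\<^sup>T *\<^sub>v (A *\<^sub>v (R *\<^sub>v v))"
      have dv: "dim_vec v = n" using v by simp
      have "v \<bullet> (sketch_gram S *\<^sub>v v) = v \<bullet> (R *\<^sub>v (A\<^sup>T *\<^sub>v (S *\<^sub>v u)))"
        by (simp add: sketch_gram_def mult_vec_assoc_dim u_def dv S)
      also have "\<dots> = (R *\<^sub>v v) \<bullet> (A\<^sup>T *\<^sub>v (S *\<^sub>v u))"
        using scalar_prod_transpose_dim[of v R "A\<^sup>T *\<^sub>v (S *\<^sub>v u)"] by (simp add: dv Rt)
      also have "\<dots> = (A *\<^sub>v (R *\<^sub>v v)) \<bullet> (S *\<^sub>v u)"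
        using scalar_prod_transpose_dim[of "R *\<^sub>v v" "A\<^sup>T" "S *\<^sub>v u"] by (simp add: S)
      also have "\<dots> = u \<bullet> u"
        using scalar_prod_transpose_dim[of "A *\<^sub>v (R *\<^sub>v v)" S u] by (simp add: S u_def)
      finally have "v \<bullet> (sketch_gram S *\<^sub>v v) = u \<bullet> u" .
      then show "v \<bullet> (sketch_gram S *\<^sub>v v) \<ge> 0" using scalar_prod_self_nonneg by simp
    qed
  qed
  then have "(\<lambda>S. (1\<^sub>m n) $$ (i, j) - (1\<^sub>m n - sketch_proj S) $$ (i, j)) \<in> borel_measurable (mat_space m)"
    by simp
  moreover have "sketch_proj S $$ (i, j) = (1\<^sub>m n) $$ (i, j) - (1\<^sub>m n - sketch_proj S) $$ (i, j)"
    if "S \<in> space (mat_space m)" for S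
  proof -
    have "sketch_proj S \<in> carrier_mat n n" using that by (simp add: space_mat_space sketch_proj_facts)
    then show ?thesis using ij by simp
  qed
  ultimately show "(\<lambda>S. sketch_proj S $$ (i, j)) \<in> borel_measurable (mat_space m)"
    by (simp cong: measurable_cong)
qed

end

section \<open>Expectation of the sketch projection\<close>

lemma scalar_prod_sum: "dim_vec v = n \<Longrightarrow> u \<bullet> v = (\<Sum>i<n. u $ i * v $ i)"
  by (simp add: scalar_prod_def atLeast0LessThan)

lemma mult_vec_index_sum:
  "M \<in> carrier_mat r n \<Longrightarrow> v \<in> carrier_vec n \<Longrightarrow> i < r \<Longrightarrow> (M *\<^sub>v v) $ i = (\<Sum>j<n. M $$ (i, j) * v $ j)"
  by (simp add: scalar_prod_sum)

lemma quadratic_form_sum: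
  fixes M :: "real mat"
  assumes "M \<in> carrier_mat n n" "u \<in> carrier_vec n" "v \<in> carrier_vec n"
  shows "u \<bullet> (M *\<^sub>v v) = (\<Sum>i<n. \<Sum>j<n. u $ i * v $ j * M $$ (i, j))"
proof -
  have "u \<bullet> (M *\<^sub>v v) = (\<Sum>i<n. u $ i * (M *\<^sub>v v) $ i)" using assms by (simp add: scalar_prod_sum)
  also have "\<dots> = (\<Sum>i<n. u $ i * (\<Sum>j<n. M $$ (i, j) * v $ j))"
    by (rule sum.cong) (use mult_vec_index_sum[OF assms(1,3)] in auto)
  finally show ?thesis by (auto simp: sum_distrib_left algebra_simps intro!: sum.cong)
qed

lemma expect_mat_carrier [simp]: "expect_mat M r c F \<in> carrier_mat r c"
  by (simp add: expect_mat_def)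

lemma expect_mat_cong: "(\<And>w. w \<in> space M \<Longrightarrow> F w = G w) \<Longrightarrow> expect_mat M r c F = expect_mat M r c G"
  unfolding expect_mat_def by (intro cong_mat refl) (simp cong: Bochner_Integration.integral_cong)

lemma integral_double_sum:
  fixes f :: "nat \<Rightarrow> nat \<Rightarrow> 'w \<Rightarrow> real"
  assumes int: "\<And>k l. k < n \<Longrightarrow> l < n \<Longrightarrow> integrable M (f k l)"
  shows "integrable M (\<lambda>w. \<Sum>k<n. \<Sum>l<n. c k l * f k l w)"
    and "(\<integral>w. (\<Sum>k<n. \<Sum>l<n. c k l * f k l w) \<partial>M) = (\<Sum>k<n. \<Sum>l<n. c k l * (\<integral>w. f k l w \<partial>M))"
proof -
  have i1: "integrable M (\<lambda>w. c k l * f k l w)" if "k < n" "l < n" for k l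
    using int[OF that] by simp
  have i2: "integrable M (\<lambda>w. \<Sum>l<n. c k l * f k l w)" if "k < n" for k
    by (rule Bochner_Integration.integrable_sum, rule i1[OF that]) auto
  show "integrable M (\<lambda>w. \<Sum>k<n. \<Sum>l<n. c k l * f k l w)"
    by (rule Bochner_Integration.integrable_sum, rule i2) auto
  have "(\<integral>w. (\<Sum>k<n. \<Sum>l<n. c k l * f k l w) \<partial>M) = (\<Sum>k<n. \<integral>w. (\<Sum>l<n. c k l * f k l w) \<partial>M)"
    by (rule Bochner_Integration.integral_sum, rule i2) auto
  also have "\<dots> = (\<Sum>k<n. \<Sum>l<n. \<integral>w. c k l * f k l w \<partial>M)"
    by (rule sum.cong[OF refl], rule Bochner_Integration.integral_sum, rule i1) auto
  finally show "(\<integral>w. (\<Sum>k<n. \<Sum>l<n. c k l * f k l w) \<partial>M) = (\<Sum>k<n. \<Sum>l<n. c k l * (\<integral>w. f k l w \<partial>M))"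
    unfolding integral_mult_right_zero .
qed

lemma expect_mat_sandwich:
  fixes C E :: "real mat"
  assumes F: "\<And>w. w \<in> space M \<Longrightarrow> F w \<in> carrier_mat n n"
    and int: "\<And>i j. i < n \<Longrightarrow> j < n \<Longrightarrow> integrable M (\<lambda>w. F w $$ (i, j))"
    and C: "C \<in> carrier_mat n n" and E: "E \<in> carrier_mat n n"
  shows "expect_mat M n n (\<lambda>w. C * (F w * E)) = C * (expect_mat M n n F * E)"
proof (rule eq_matI)
  have idx: "(C * (X * E)) $$ (i, j) = (\<Sum>k<n. \<Sum>l<n. C $$ (i, k) * E $$ (l, j) * X $$ (k, l))"
    if ij: "i < n" "j < n" and X: "X \<in> carrier_mat n n" for i j X
  proof -
    have XE: "X * E \<in> carrier_mat n n" using X E by simp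
    have "(C * (X * E)) $$ (i, j) = (\<Sum>k<n. C $$ (i, k) * (X * E) $$ (k, j))"
      by (rule mult_mat_index_sum[OF C XE ij])
    also have "\<dots> = (\<Sum>k<n. C $$ (i, k) * (\<Sum>l<n. X $$ (k, l) * E $$ (l, j)))"
      by (rule sum.cong[OF refl]) (use mult_mat_index_sum[OF X E _ ij(2)] in auto)
    finally show ?thesis by (auto simp: sum_distrib_left algebra_simps intro!: sum.cong)
  qed
  fix i j assume "i < dim_row (C * (expect_mat M n n F * E))" "j < dim_col (C * (expect_mat M n n F * E))"
  then have ij: "i < n" "j < n" using C E by auto
  have "(\<integral>w. (C * (F w * E)) $$ (i, j) \<partial>M) = (\<integral>w. (\<Sum>k<n. \<Sum>l<n. C $$ (i, k) * E $$ (l, j) * F w $$ (k, l)) \<partial>M)"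
    by (rule Bochner_Integration.integral_cong[OF refl]) (rule idx[OF ij F])
  also have "\<dots> = (\<Sum>k<n. \<Sum>l<n. C $$ (i, k) * E $$ (l, j) * (\<integral>w. F w $$ (k, l) \<partial>M))"
    by (rule integral_double_sum(2)[OF int])
  also have "\<dots> = (C * (expect_mat M n n F * E)) $$ (i, j)"
    unfolding idx[OF ij expect_mat_carrier] by (simp add: expect_mat_def)
  finally show "expect_mat M n n (\<lambda>w. C * (F w * E)) $$ (i, j) = (C * (expect_mat M n n F * E)) $$ (i, j)"
    using ij by (simp add: expect_mat_def)
qed (use C E in \<open>auto simp: expect_mat_def\<close>)

lemma integral_quadratic_form:
  assumes F: "\<And>w. w \<in> space M \<Longrightarrow> F w \<in> carrier_mat n n"
    and int: "\<And>i j. i < n \<Longrightarrow> j < n \<Longrightarrow> integrable M (\<lambda>w. F w $$ (i, j))"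
    and u: "u \<in> carrier_vec n" and v: "v \<in> carrier_vec n"
  shows "integrable M (\<lambda>w. u \<bullet> (F w *\<^sub>v v))"
    and "(\<integral>w. u \<bullet> (F w *\<^sub>v v) \<partial>M) = u \<bullet> (expect_mat M n n F *\<^sub>v v)"
proof -
  have int2: "integrable M (\<lambda>w. \<Sum>i<n. \<Sum>j<n. u $ i * v $ j * F w $$ (i, j))"
    by (rule integral_double_sum(1)[OF int])
  have eq: "u \<bullet> (F w *\<^sub>v v) = (\<Sum>i<n. \<Sum>j<n. u $ i * v $ j * F w $$ (i, j))" if "w \<in> space M" for w
    by (rule quadratic_form_sum[OF F[OF that] u v])
  show "integrable M (\<lambda>w. u \<bullet> (F w *\<^sub>v v))"
    using int2 by (rule Bochner_Integration.integrable_cong[THEN iffD1, OF refl, rotated]) (simp add: eq)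
  have "(\<integral>w. u \<bullet> (F w *\<^sub>v v) \<partial>M) = (\<integral>w. (\<Sum>i<n. \<Sum>j<n. u $ i * v $ j * F w $$ (i, j)) \<partial>M)"
    by (rule Bochner_Integration.integral_cong[OF refl]) (rule eq)
  also have "\<dots> = (\<Sum>i<n. \<Sum>j<n. u $ i * v $ j * (\<integral>w. F w $$ (i, j) \<partial>M))"
    by (rule integral_double_sum(2)[OF int])
  also have "\<dots> = u \<bullet> (expect_mat M n n F *\<^sub>v v)"
    unfolding quadratic_form_sum[OF expect_mat_carrier u v] by (simp add: expect_mat_def)
  finally show "(\<integral>w. u \<bullet> (F w *\<^sub>v v) \<partial>M) = u \<bullet> (expect_mat M n n F *\<^sub>v v)" .
qed

locale sketched_system = whitened_system m n A B R Ri + prob_space D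
  for m n A B R Ri and D :: "real mat measure" +
  fixes b :: "real Matrix.vec"
  assumes sqrt_inv_B: "mat_sqrt (mat_inv B) = R" and sets_D: "sets D = sets (mat_space m)"
    and b: "b \<in> carrier_vec m" and consistent: "solutions A b \<noteq> {}"
begin

lemma space_D: "space D = {S. dim_row S = m}"
  using sets_eq_imp_space_eq[OF sets_D] by (simp add: space_mat_space)

lemma proj_measurable_D:
  "i < n \<Longrightarrow> j < n \<Longrightarrow> (\<lambda>S. sketch_proj S $$ (i, j)) \<in> borel_measurable D"
  using measurable_matD(2)[OF sketch_proj_measurable] measurable_cong_sets[OF sets_D refl] by blast

lemma proj_carrier: "S \<in> space D \<Longrightarrow> sketch_proj S \<in> carrier_mat n n"
  by (simp add: space_D sketch_proj_facts)

lemma proj_entry_bound: "S \<in> space D \<Longrightarrow> i < n \<Longrightarrow> j < n \<Longrightarrow> \<bar>sketch_proj S $$ (i, j)\<bar> \<le> 1"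
  by (rule orth_projection_entry_bound) (simp_all add: space_D sketch_proj_facts)

lemma proj_integrable:
  assumes "i < n" "j < n" shows "integrable D (\<lambda>S. sketch_proj S $$ (i, j))"
  by (rule integrable_const_bound[of _ 1])
    (use proj_measurable_D[OF assms] proj_entry_bound[OF _ assms] in auto)

abbreviation W where "W \<equiv> expect_mat D n n sketch_proj"

text \<open>\<open>Z\<^sub>S = Ri P\<^sub>S Ri\<close>, so the outer square roots in the definition cancel after they are moved through the expectation.\<close>

lemma W_mat_eq: "W_mat A B D = W"
proof -
  have "expect_mat D n n (Z_mat A B) = expect_mat D n n (\<lambda>S. Ri * (sketch_proj S * Ri))"
    by (rule expect_mat_cong) (simp add: space_D Z_from_proj)
  also have "\<dots> = Ri * (W * Ri)"
    by (rule expect_mat_sandwich[OF _ _ Ri Ri]) (simp_all add: proj_carrier proj_integrable)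
  finally have E: "expect_mat D n n (Z_mat A B) = Ri * (W * Ri)" .
  have d: "dim_row W = n" "dim_col W = n" by (simp_all add: expect_mat_def)
  have "W_mat A B D = R * (Ri * (W * (Ri * R)))"
    by (simp add: W_mat_def sqrt_inv_B E mult_assoc_dim d)
  then show ?thesis by (simp add: RiR R_cancel d right_mult_one_mat')
qed

lemma W_symmetric: "W\<^sup>T = W"
proof (rule eq_matI)
  fix i j assume "i < dim_row W" "j < dim_col W"
  then have ij: "i < n" "j < n" by (auto simp: expect_mat_def)
  have "sketch_proj S $$ (j, i) = sketch_proj S $$ (i, j)" if "S \<in> space D" for S
  proof -
    have S: "dim_row S = m" using that by (simp add: space_D)
    note f = sketch_proj_facts(3,4)[OF S]
    have "(sketch_proj S)\<^sup>T $$ (i, j) = sketch_proj S $$ (j, i)" using f(1) ij by simp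
    then show ?thesis by (simp add: f(2))
  qed
  then have "(\<integral>S. sketch_proj S $$ (j, i) \<partial>D) = (\<integral>S. sketch_proj S $$ (i, j) \<partial>D)"
    by (intro Bochner_Integration.integral_cong) auto
  then show "W\<^sup>T $$ (i, j) = W $$ (i, j)" using ij by (simp add: expect_mat_def)
qed (auto simp: expect_mat_def)

lemma integral_proj_form:
  assumes v: "v \<in> carrier_vec n"
  shows "integrable D (\<lambda>S. v \<bullet> (sketch_proj S *\<^sub>v v))"
    and "(\<integral>S. v \<bullet> (sketch_proj S *\<^sub>v v) \<partial>D) = v \<bullet> (W *\<^sub>v v)"
  by (rule integral_quadratic_form[OF _ _ v v]; simp add: proj_carrier proj_integrable)+

lemma W_quadratic_form:
  assumes v: "v \<in> carrier_vec n"
  shows "0 \<le> v \<bullet> (W *\<^sub>v v)" "v \<bullet> (W *\<^sub>v v) \<le> v \<bullet> v"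
proof -
  note q = integral_proj_form[OF v]
  have o: "0 \<le> v \<bullet> (sketch_proj S *\<^sub>v v)" "v \<bullet> (sketch_proj S *\<^sub>v v) \<le> v \<bullet> v" if "S \<in> space D" for S
  proof -
    have S: "dim_row S = m" using that by (simp add: space_D)
    show "0 \<le> v \<bullet> (sketch_proj S *\<^sub>v v)" "v \<bullet> (sketch_proj S *\<^sub>v v) \<le> v \<bullet> v"
      by (rule orth_projection_quadratic_form[OF sketch_proj_facts(3-5)[OF S] v])+
  qed
  show "0 \<le> v \<bullet> (W *\<^sub>v v)" unfolding q(2)[symmetric] by (rule integral_nonneg_AE) (use o in auto)
  have "(\<integral>S. v \<bullet> (sketch_proj S *\<^sub>v v) \<partial>D) \<le> (\<integral>S. v \<bullet> v \<partial>D)"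
    by (rule integral_mono) (use o q(1) in auto)
  then show "v \<bullet> (W *\<^sub>v v) \<le> v \<bullet> v" unfolding q(2)[symmetric] by (simp add: prob_space)
qed

lemma f_sample_whitened:
  assumes S: "dim_row S = m" and y: "y \<in> solutions A b" and x: "x \<in> carrier_vec n"
  shows "f_sample A b B S x = 1 / 2 * ((Ri *\<^sub>v (x - y)) \<bullet> (sketch_proj S *\<^sub>v (Ri *\<^sub>v (x - y))))"
proof -
  have y': "y \<in> carrier_vec n" "A *\<^sub>v y = b" using y by (auto simp: solutions_def)
  define e where "e = x - y"
  have e: "dim_vec e = n" using x y' by (simp add: e_def)
  have Axb: "A *\<^sub>v x - b = A *\<^sub>v e"
    unfolding e_def y'(2)[symmetric] by (rule mult_minus_distrib_mat_vec[OF A x y'(1), symmetric])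
  note f = sketch_proj_facts[OF S]
  have dZ: "dim_row (Z_mat A B S) = n" "dim_col (Z_mat A B S) = n" using f(1) by auto
  have dP: "dim_row (sketch_proj S) = n" "dim_col (sketch_proj S) = n" using f(3) by auto
  have dH: "dim_row (H_mat A B S) = m" "dim_col (H_mat A B S) = m" by (simp_all add: H_mat_def S)
  have "(A *\<^sub>v e) \<bullet> (H_mat A B S *\<^sub>v (A *\<^sub>v e)) = e \<bullet> (A\<^sup>T *\<^sub>v (H_mat A B S *\<^sub>v (A *\<^sub>v e)))"
    using scalar_prod_transpose_dim[of e "A\<^sup>T" "H_mat A B S *\<^sub>v (A *\<^sub>v e)"] by (simp add: e dH)
  also have "\<dots> = e \<bullet> (Z_mat A B S *\<^sub>v e)"
    by (simp add: Z_mat_def mult_vec_assoc_dim e dH)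
  also have "\<dots> = e \<bullet> (Ri *\<^sub>v (sketch_proj S *\<^sub>v (Ri *\<^sub>v e)))"
    unfolding Z_from_proj[OF S] by (simp add: mult_vec_assoc_dim e dP)
  also have "\<dots> = (Ri *\<^sub>v e) \<bullet> (sketch_proj S *\<^sub>v (Ri *\<^sub>v e))"
    using scalar_prod_transpose_dim[of e Ri "sketch_proj S *\<^sub>v (Ri *\<^sub>v e)"] by (simp add: e Rit dP)
  finally show ?thesis by (simp add: f_sample_def Axb e_def)
qed

lemma f_mean_whitened:
  assumes y: "y \<in> solutions A b" and x: "x \<in> carrier_vec n"
  shows "f_mean A b B D x = 1 / 2 * ((Ri *\<^sub>v (x - y)) \<bullet> (W *\<^sub>v (Ri *\<^sub>v (x - y))))"
proof -
  have "x - y \<in> carrier_vec n" using x y by (simp add: solutions_def)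
  then have u: "Ri *\<^sub>v (x - y) \<in> carrier_vec n" using Ri by simp
  have "f_mean A b B D x
      = (\<integral>S. 1 / 2 * ((Ri *\<^sub>v (x - y)) \<bullet> (sketch_proj S *\<^sub>v (Ri *\<^sub>v (x - y)))) \<partial>D)"
    unfolding f_mean_def
    by (rule Bochner_Integration.integral_cong[OF refl]) (simp add: space_D f_sample_whitened[OF _ y x])
  also have "\<dots> = 1 / 2 * (\<integral>S. ((Ri *\<^sub>v (x - y)) \<bullet> (sketch_proj S *\<^sub>v (Ri *\<^sub>v (x - y)))) \<partial>D)"
    by (rule integral_mult_right_zero)
  finally show ?thesis
    unfolding integral_proj_form(2)[OF u] .
qed

text \<open>If \<open>W v = 0\<close>, then for a solution \<open>y\<close> the point \<open>y + R v\<close> has \<open>f = 0\<close>, the least possible value. By exactness it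
solves the system, as \<open>y\<close> does.\<close>

lemma exactness_kernel:
  assumes exact: "exactness A b B D" and v: "v \<in> carrier_vec n" and Wv: "W *\<^sub>v v = 0\<^sub>v n"
  shows "A *\<^sub>v (R *\<^sub>v v) = 0\<^sub>v m"
proof -
  obtain y where y: "y \<in> solutions A b" using consistent by blast
  then have y': "y \<in> carrier_vec n" "A *\<^sub>v y = b" by (auto simp: solutions_def)
  define x where "x = y + R *\<^sub>v v"
  have Rv: "R *\<^sub>v v \<in> carrier_vec n" using R v by simp
  have x: "x \<in> carrier_vec n" using y' Rv by (simp add: x_def)
  have "x - y = R *\<^sub>v v" using y' Rv by (auto simp: x_def)
  then have "f_mean A b B D x = 0"
    using v by (simp add: f_mean_whitened[OF y x] R_cancel_vec Wv)
  moreover have "f_mean A b B D z \<ge> 0" if z: "z \<in> carrier_vec n" for z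
    using W_quadratic_form(1)[of "Ri *\<^sub>v (z - y)"] y'(1) Ri z by (simp add: f_mean_whitened[OF y z])
  ultimately have "x \<in> solutions A b"
    using exact x unfolding exactness_def by auto
  then have "A *\<^sub>v y + A *\<^sub>v (R *\<^sub>v v) = b"
    using mult_add_distrib_mat_vec[OF A y'(1) Rv] by (simp add: x_def solutions_def)
  then have eq: "(b + A *\<^sub>v (R *\<^sub>v v)) $ i = b $ i" for i by (simp add: y')
  show ?thesis
  proof (rule eq_vecI)
    fix i assume "i < dim_vec (0\<^sub>v m)"
    then have i: "i < m" by simp
    then have "(b + A *\<^sub>v (R *\<^sub>v v)) $ i = b $ i + (A *\<^sub>v (R *\<^sub>v v)) $ i"
      by (intro index_add_vec) simp
    then show "(A *\<^sub>v (R *\<^sub>v v)) $ i = 0\<^sub>v m $ i" using eq[of i] i by simp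
  qed simp
qed

end

section \<open>Gradients and the projection onto the solution set\<close>

context whitened_system
begin

lemma dim_B [simp]: "dim_row B = n" "dim_col B = n"
  by (simp_all add: B_eq)

lemma inner_B_whitened:
  assumes "u \<in> carrier_vec n" "v \<in> carrier_vec n"
  shows "inner_B B u v = (Ri *\<^sub>v u) \<bullet> (Ri *\<^sub>v v)"
proof -
  have d: "dim_vec u = n" "dim_vec v = n" using assms by auto
  have "inner_B B u v = u \<bullet> (Ri *\<^sub>v (Ri *\<^sub>v v))"
    unfolding inner_B_def B_eq by (simp add: mult_vec_assoc_dim d)
  also have "\<dots> = (Ri *\<^sub>v u) \<bullet> (Ri *\<^sub>v v)"
    using scalar_prod_transpose_dim[of u Ri "Ri *\<^sub>v v"] by (simp add: Rit d)
  finally show ?thesis .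
qed

lemma norm_B_whitened:
  "v \<in> carrier_vec n \<Longrightarrow> norm_B B v = sqrt ((Ri *\<^sub>v v) \<bullet> (Ri *\<^sub>v v))"
  by (simp add: norm_B_def inner_B_whitened)

lemma Ri_carrier: "v \<in> carrier_vec n \<Longrightarrow> Ri *\<^sub>v v \<in> carrier_vec n"
  using Ri by simp

lemma Ri_diff: "u \<in> carrier_vec n \<Longrightarrow> v \<in> carrier_vec n \<Longrightarrow> Ri *\<^sub>v (u - v) = Ri *\<^sub>v u - Ri *\<^sub>v v"
  by (rule mult_minus_distrib_mat_vec[OF Ri])

lemma Ri_eq_0:
  assumes v: "v \<in> carrier_vec n" and 0: "Ri *\<^sub>v v = 0\<^sub>v n"
  shows "v = 0\<^sub>v n"
proof -
  have "v = R *\<^sub>v (Ri *\<^sub>v v)" using v by (simp add: R_cancel_vec)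
  also have "\<dots> = 0\<^sub>v n" unfolding 0 using R by (intro eq_vecI) auto
  finally show ?thesis .
qed

text \<open>Test both approximations on a small multiple \<open>t (g - g')\<close> of the difference, with tolerance a quarter of its
norm \<open>N\<close>: the two inner products differ by \<open>t N\<^sup>2\<close>, while the approximations allow only \<open>t N\<^sup>2 / 2\<close>.\<close>

lemma gradient_B_unique:
  assumes g: "has_gradient_B B f g x" and h: "has_gradient_B B f g' x"
  shows "g = g'"
proof (rule ccontr)
  assume ne: "g \<noteq> g'"
  have gc: "g \<in> carrier_vec n" "g' \<in> carrier_vec n"
    using g h by (auto simp: has_gradient_B_def)
  define z where "z = Ri *\<^sub>v (g - g')"
  have zc: "z \<in> carrier_vec n" using gc Ri_carrier by (simp add: z_def)
  have "z \<noteq> 0\<^sub>v n"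
  proof
    assume "z = 0\<^sub>v n"
    then have eq: "g - g' = 0\<^sub>v n" using Ri_eq_0[of "g - g'"] gc by (simp add: z_def)
    have "g $ i = g' $ i" if "i < n" for i
      using arg_cong[OF eq, of "\<lambda>v. v $ i"] that gc by simp
    then show False using ne gc by (metis carrier_vecD eq_vecI)
  qed
  then have pos: "z \<bullet> z > 0" by (rule scalar_prod_self_pos[OF zc])
  define N where "N = sqrt (z \<bullet> z)"
  have N: "N > 0" "z \<bullet> z = N * N" using pos by (auto simp: N_def)
  have e: "N / 4 > 0" using N by simp
  obtain d where d: "d > 0" "\<And>h. h \<in> carrier_vec n \<Longrightarrow> norm_B B h < d \<Longrightarrow>
      \<bar>f (x + h) - f x - inner_B B g h\<bar> \<le> N / 4 * norm_B B h"
    using g e unfolding has_gradient_B_def dim_B by blast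
  obtain d' where d': "d' > 0" "\<And>h. h \<in> carrier_vec n \<Longrightarrow> norm_B B h < d' \<Longrightarrow>
      \<bar>f (x + h) - f x - inner_B B g' h\<bar> \<le> N / 4 * norm_B B h"
    using h e unfolding has_gradient_B_def dim_B by blast
  define t where "t = min d d' / (2 * N)"
  have t: "t > 0" using d(1) d'(1) N by (simp add: t_def)
  define k where "k = t \<cdot>\<^sub>v (g - g')"
  have kc: "k \<in> carrier_vec n" using gc by (simp add: k_def)
  have Rk: "Ri *\<^sub>v k = t \<cdot>\<^sub>v z"
    unfolding k_def z_def using gc by (intro mult_mat_vec[OF Ri]) simp
  have "(t \<cdot>\<^sub>v z) \<bullet> (t \<cdot>\<^sub>v z) = (t * N)\<^sup>2"
    using zc by (simp add: N power2_eq_square)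
  then have nk: "norm_B B k = t * N"
    using t N by (simp add: norm_B_whitened[OF kc] Rk)
  have "t * N = min d d' / 2" using N by (simp add: t_def)
  then have small: "norm_B B k < d" "norm_B B k < d'" using d(1) d'(1) nk by auto
  have "inner_B B g k - inner_B B g' k = t * (N * N)"
  proof -
    have Rg: "Ri *\<^sub>v g \<in> carrier_vec n" "Ri *\<^sub>v g' \<in> carrier_vec n" using gc Ri_carrier by auto
    have "inner_B B g k - inner_B B g' k = (Ri *\<^sub>v g - Ri *\<^sub>v g') \<bullet> (t \<cdot>\<^sub>v z)"
      using gc kc Rg zc by (simp add: inner_B_whitened Rk minus_scalar_prod_distrib[of _ n] right_diff_distrib)
    then show ?thesis using zc by (simp add: Ri_diff[OF gc, symmetric] z_def[symmetric] N)
  qed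
  moreover have "inner_B B g k - inner_B B g' k \<le> 2 * (N / 4 * (t * N))"
    using d(2)[OF kc small(1)] d'(2)[OF kc small(2)] unfolding nk by linarith
  ultimately show False using t N(1) by (simp add: field_simps)
qed

text \<open>For the sketch \<open>S = I\<close> the matrix \<open>Z\<close> satisfies \<open>A B\<^sup>-\<^sup>1 Z = A\<close>. Hence subtracting \<open>B\<^sup>-\<^sup>1 Z (x\<^sub>0 - y)\<close>, for any
solution \<open>y\<close>, moves \<open>x\<^sub>0\<close> into the solution set along the range of \<open>B\<^sup>-\<^sup>1 A\<^sup>T\<close>, which is \<open>B\<close>-orthogonal to it. By
Pythagoras the point reached is the unique minimizer of the distance, so it is the one that \<open>proj_B\<close> selects.\<close>

lemma projection_onto_solutions:
  assumes x0: "x0 \<in> carrier_vec n" and b: "b \<in> carrier_vec m" and consistent: "solutions A b \<noteq> {}"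
  shows "proj_B B (solutions A b) x0 \<in> solutions A b"
    and "\<exists>u \<in> carrier_vec m. Ri *\<^sub>v (x0 - proj_B B (solutions A b) x0) = R *\<^sub>v (A\<^sup>T *\<^sub>v u)"
proof -
  obtain y where "y \<in> solutions A b" using consistent by blast
  then have y: "y \<in> carrier_vec n" "A *\<^sub>v y = b" by (auto simp: solutions_def)
  define Z where "Z = Z_mat A B (1\<^sub>m m)"
  note f = sketch_proj_facts[OF index_one_mat(2)[of m], folded Z_def]
  obtain Y where Y: "Y \<in> carrier_mat n m" "Z = A\<^sup>T * Y\<^sup>T" using f(9) by blast
  have dZ: "dim_row Z = n" "dim_col Z = n" using f(1) by auto
  have At: "A\<^sup>T \<in> carrier_mat n m" using A by simp
  have "Ri * (R * (Z * (R * (R * A\<^sup>T)))) = Ri * (R * A\<^sup>T)"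
    using f(6) by (simp add: sketch_proj_def Z_def[symmetric] mult_assoc_dim dZ right_mult_one_mat[OF At])
  then have "Z * (R * (R * A\<^sup>T)) = A\<^sup>T" by (simp add: R_cancel dZ)
  then have "(Z * (R * (R * A\<^sup>T)))\<^sup>T = A" by simp
  then have AZ: "A * (R * (R * Z)) = A"
    by (simp add: transpose_mult_dim mult_assoc_dim dZ Rt f(2))
  define e where "e = x0 - y"
  have e: "e \<in> carrier_vec n" using x0 y by (simp add: e_def)
  have dY: "dim_row Y = n" "dim_col Y = m" using Y(1) by auto
  define u where "u = Y\<^sup>T *\<^sub>v e"
  have u: "u \<in> carrier_vec m" using Y e by (simp add: u_def)
  define p where "p = R *\<^sub>v (R *\<^sub>v (Z *\<^sub>v e))"
  have p: "p \<in> carrier_vec n" using R f(1) e by (simp add: p_def)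
  have p_u: "Ri *\<^sub>v p = R *\<^sub>v (A\<^sup>T *\<^sub>v u)"
    using e unfolding p_def by (simp add: R_cancel_vec dZ) (simp add: Y(2) u_def mult_vec_assoc_dim dY)
  have Ap: "A *\<^sub>v p = A *\<^sub>v e"
    using arg_cong[OF AZ, of "\<lambda>M. M *\<^sub>v e"] e by (simp add: p_def mult_vec_assoc_dim dZ)
  define xs where "xs = x0 - p"
  have xs: "xs \<in> carrier_vec n" using x0 p by (simp add: xs_def)
  have "A *\<^sub>v xs = A *\<^sub>v x0 - A *\<^sub>v (x0 - y)"
    using mult_minus_distrib_mat_vec[OF A x0 p] Ap by (simp add: xs_def e_def)
  also have "\<dots> = A *\<^sub>v y"
    unfolding mult_minus_distrib_mat_vec[OF A x0 y(1)] using A x0 y(1) by (intro eq_vecI) auto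
  finally have xs_sol: "xs \<in> solutions A b" using xs y by (simp add: solutions_def)
  have x0xs: "x0 - xs = p" unfolding xs_def using x0 p by (intro eq_vecI) auto
  define q where "q = Ri *\<^sub>v p"
  have q: "q \<in> carrier_vec n" using p Ri_carrier by (simp add: q_def)
  have pyth: "(norm_B B (x0 - z))\<^sup>2 = q \<bullet> q + (Ri *\<^sub>v (xs - z)) \<bullet> (Ri *\<^sub>v (xs - z))"
    if z: "z \<in> solutions A b" for z
  proof -
    have zc: "z \<in> carrier_vec n" "A *\<^sub>v z = b" using z by (auto simp: solutions_def)
    define w where "w = xs - z"
    have w: "w \<in> carrier_vec n" using xs zc by (simp add: w_def)
    have Rw: "Ri *\<^sub>v w \<in> carrier_vec n" by (rule Ri_carrier[OF w])
    have "A *\<^sub>v w = A *\<^sub>v xs - A *\<^sub>v z" unfolding w_def by (rule mult_minus_distrib_mat_vec[OF A xs zc(1)])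
    then have Aw: "A *\<^sub>v w = 0\<^sub>v m" using xs_sol zc b by (simp add: solutions_def)
    have "q \<bullet> (Ri *\<^sub>v w) = (A\<^sup>T *\<^sub>v u) \<bullet> (R *\<^sub>v (Ri *\<^sub>v w))"
      using scalar_prod_transpose_dim[of "A\<^sup>T *\<^sub>v u" R "Ri *\<^sub>v w"] by (simp add: q_def p_u Rt)
    also have "\<dots> = u \<bullet> (A *\<^sub>v w)"
      using scalar_prod_transpose_dim[of u A w] u w by (simp add: R_cancel_vec)
    finally have orth: "q \<bullet> (Ri *\<^sub>v w) = 0" using u by (simp add: Aw)
    have "x0 - z = p + w" using x0 p zc unfolding w_def xs_def by (intro eq_vecI) auto
    then have "Ri *\<^sub>v (x0 - z) = q + Ri *\<^sub>v w"
      using mult_add_distrib_mat_vec[OF Ri p w] by (simp add: q_def)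
    then have "(norm_B B (x0 - z))\<^sup>2 = (q + Ri *\<^sub>v w) \<bullet> (q + Ri *\<^sub>v w)"
      using x0 zc scalar_prod_self_nonneg[of "Ri *\<^sub>v (x0 - z)"] by (simp add: norm_B_whitened)
    also have "\<dots> = q \<bullet> q + (Ri *\<^sub>v w) \<bullet> (Ri *\<^sub>v w)"
      using q Rw orth scalar_prod_commute_dim[of "Ri *\<^sub>v w" q]
      by (simp add: add_scalar_prod_distrib[of _ n] scalar_prod_add_distrib[of _ n])
    finally show ?thesis by (simp add: w_def)
  qed
  have nn: "norm_B B (x0 - z) \<ge> 0" if "z \<in> solutions A b" for z
    using that x0 scalar_prod_self_nonneg[of "Ri *\<^sub>v (x0 - z)"]
    by (simp add: norm_B_whitened solutions_def)
  have xsxs: "(Ri *\<^sub>v (xs - xs)) \<bullet> (Ri *\<^sub>v (xs - xs)) = 0"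
    using xs Ri_diff[OF xs xs] Ri_carrier[OF xs] by simp
  have min: "is_arg_min (\<lambda>z. norm_B B (x0 - z)) (\<lambda>z. z \<in> solutions A b) xs"
    unfolding is_arg_min_def
  proof (intro conjI notI xs_sol)
    assume "\<exists>z. z \<in> solutions A b \<and> norm_B B (x0 - z) < norm_B B (x0 - xs)"
    then obtain z where z: "z \<in> solutions A b" "norm_B B (x0 - z) < norm_B B (x0 - xs)" by blast
    then have "(norm_B B (x0 - z))\<^sup>2 < (norm_B B (x0 - xs))\<^sup>2"
      using nn[OF z(1)] by (intro power_strict_mono) auto
    then show False
      using pyth[OF z(1)] pyth[OF xs_sol] xsxs scalar_prod_self_nonneg[of "Ri *\<^sub>v (xs - z)"] by linarith
  qed
  define z where "z = proj_B B (solutions A b) x0"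
  have "is_arg_min (\<lambda>z. norm_B B (x0 - z)) (\<lambda>z. z \<in> solutions A b) z"
    unfolding z_def proj_B_def arg_min_def by (rule someI[of _ xs]) (rule min)
  then have z: "z \<in> solutions A b" and zmin: "\<not> norm_B B (x0 - xs) < norm_B B (x0 - z)"
    using xs_sol by (auto simp: is_arg_min_def)
  have zc: "z \<in> carrier_vec n" using z by (simp add: solutions_def)
  have "(norm_B B (x0 - z))\<^sup>2 \<le> (norm_B B (x0 - xs))\<^sup>2"
    using zmin nn[OF z] by (intro power_mono) auto
  then have "(Ri *\<^sub>v (xs - z)) \<bullet> (Ri *\<^sub>v (xs - z)) = 0"
    using pyth[OF z] pyth[OF xs_sol] xsxs scalar_prod_self_nonneg[of "Ri *\<^sub>v (xs - z)"] by linarith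
  then have "Ri *\<^sub>v (xs - z) = 0\<^sub>v n"
    using scalar_prod_self_eq_0[OF Ri_carrier, of "xs - z"] xs zc by simp
  then have eq: "xs - z = 0\<^sub>v n" using Ri_eq_0[of "xs - z"] xs zc by simp
  have "xs $ i = z $ i" if "i < n" for i
    using arg_cong[OF eq, of "\<lambda>v. v $ i"] that xs zc by simp
  then have "z = xs" using xs zc by (intro eq_vecI) auto
  then show "proj_B B (solutions A b) x0 \<in> solutions A b"
    and "\<exists>u \<in> carrier_vec m. Ri *\<^sub>v (x0 - proj_B B (solutions A b) x0) = R *\<^sub>v (A\<^sup>T *\<^sub>v u)"
    using xs_sol u x0xs p_u by (auto simp: z_def)
qed

end

context sketched_system
begin

text \<open>In whitened coordinates \<open>f\<^sub>S\<close> is the quadratic form \<open>w \<bullet> P\<^sub>S w / 2\<close>, with gradient \<open>P\<^sub>S w\<close>; its remainder is half the form of a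
projection and so at most the squared norm of the increment.\<close>

lemma gradient_f_sample:
  assumes S: "dim_row S = m" and y: "y \<in> solutions A b" and x: "x \<in> carrier_vec n"
  shows "gradient_B B (f_sample A b B S) x = R *\<^sub>v (sketch_proj S *\<^sub>v (Ri *\<^sub>v (x - y)))"
proof -
  have y': "y \<in> carrier_vec n" using y by (simp add: solutions_def)
  note f = sketch_proj_facts(3-5)[OF S]
  define P where "P = sketch_proj S"
  define w where "w = Ri *\<^sub>v (x - y)"
  define g where "g = R *\<^sub>v (P *\<^sub>v w)"
  have P: "P \<in> carrier_mat n n" "P\<^sup>T = P" using f by (simp_all add: P_def)
  have w: "w \<in> carrier_vec n" unfolding w_def using x y' by (intro Ri_carrier) simp
  have Pw: "P *\<^sub>v w \<in> carrier_vec n" using P w by simp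
  have g: "g \<in> carrier_vec n" using R Pw by (simp add: g_def)
  have rem: "f_sample A b B S (x + h) - f_sample A b B S x - inner_B B g h
      = 1 / 2 * ((Ri *\<^sub>v h) \<bullet> (P *\<^sub>v (Ri *\<^sub>v h)))" if h: "h \<in> carrier_vec n" for h
  proof -
    define k where "k = Ri *\<^sub>v h"
    have k: "k \<in> carrier_vec n" unfolding k_def by (rule Ri_carrier[OF h])
    have Pk: "P *\<^sub>v k \<in> carrier_vec n" using P k by simp
    have xh: "x + h \<in> carrier_vec n" and xy: "x - y \<in> carrier_vec n" using x h y' by auto
    have "x + h - y = (x - y) + h" using x h y' by (intro eq_vecI) auto
    then have "Ri *\<^sub>v (x + h - y) = w + k"
      using mult_add_distrib_mat_vec[OF Ri xy h] by (simp add: w_def k_def)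
    then have 1: "f_sample A b B S (x + h) = 1 / 2 * ((w + k) \<bullet> (P *\<^sub>v w + P *\<^sub>v k))"
      by (simp add: f_sample_whitened[OF S y xh] P_def[symmetric] mult_add_distrib_mat_vec[OF P(1) w k])
    have 2: "f_sample A b B S x = 1 / 2 * (w \<bullet> (P *\<^sub>v w))"
      by (simp add: f_sample_whitened[OF S y x] P_def w_def)
    have 3: "inner_B B g h = (P *\<^sub>v w) \<bullet> k"
      unfolding inner_B_whitened[OF g h] unfolding g_def k_def[symmetric]
      using carrier_matD[OF P(1)] by (subst R_cancel_vec(2)) simp_all
    have 4: "w \<bullet> (P *\<^sub>v k) = (P *\<^sub>v w) \<bullet> k"
      using scalar_prod_transpose_dim[of w P k] P w k by simp
    have 5: "k \<bullet> (P *\<^sub>v w) = (P *\<^sub>v w) \<bullet> k"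
      using Pw k P by (intro scalar_prod_commute_dim) simp
    show ?thesis unfolding 1 2 3 k_def[symmetric]
      using w k Pw Pk 4 5
      by (simp add: add_scalar_prod_distrib[of _ n] scalar_prod_add_distrib[of _ n] field_simps)
  qed
  have "has_gradient_B B (f_sample A b B S) g x"
    unfolding has_gradient_B_def dim_B
  proof (intro conjI allI impI g)
    fix e :: real assume e: "e > 0"
    show "\<exists>d>0. \<forall>h\<in>carrier_vec n. norm_B B h < d \<longrightarrow>
        \<bar>f_sample A b B S (x + h) - f_sample A b B S x - inner_B B g h\<bar> \<le> e * norm_B B h"
    \<comment> \<open>the remainder is at most \<open>norm_B B h * norm_B B h\<close>, so the radius \<open>e\<close> itself works\<close>
    proof (intro exI[of _ e] conjI e ballI impI)
      fix h assume h: "h \<in> carrier_vec n" and small: "norm_B B h < e"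
      have k: "Ri *\<^sub>v h \<in> carrier_vec n" by (rule Ri_carrier[OF h])
      note o = orth_projection_quadratic_form[OF f k, folded P_def]
      have nn: "norm_B B h \<ge> 0" "norm_B B h * norm_B B h = (Ri *\<^sub>v h) \<bullet> (Ri *\<^sub>v h)"
        using scalar_prod_self_nonneg[of "Ri *\<^sub>v h"] by (simp_all add: norm_B_whitened[OF h])
      have "\<bar>1 / 2 * ((Ri *\<^sub>v h) \<bullet> (P *\<^sub>v (Ri *\<^sub>v h)))\<bar> \<le> norm_B B h * norm_B B h"
        using o nn by simp
      also have "\<dots> \<le> e * norm_B B h" using small nn by (intro mult_right_mono) auto
      finally show "\<bar>f_sample A b B S (x + h) - f_sample A b B S x - inner_B B g h\<bar> \<le> e * norm_B B h"
        unfolding rem[OF h] .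
    qed
  qed
  then have "gradient_B B (f_sample A b B S) x = g"
    unfolding gradient_B_def using gradient_B_unique by (intro the_equality) blast+
  then show ?thesis by (simp add: g_def P_def w_def)
qed

end

section \<open>The expected error of the iterates\<close>

text \<open>A coordinate of an i.i.d. sequence is independent of any function of other coordinates; the equation \<open>gJ\<close> says
that \<open>g\<close> depends only on the coordinates in \<open>J\<close>.\<close>

lemma indep_expectation_PiM:
  fixes D :: "'a measure" and f :: "'a \<Rightarrow> real" and g :: "(nat \<Rightarrow> 'a) \<Rightarrow> real"
  assumes D: "prob_space D" and j: "j \<notin> J"
    and f: "f \<in> borel_measurable D" and g: "g \<in> borel_measurable (PiM J (\<lambda>_. D))"
    and gJ: "\<And>s. g (restrict s J) = g s"
    and intf: "integrable D f" and intg: "integrable (PiM UNIV (\<lambda>_. D)) g"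
  shows "integrable (PiM UNIV (\<lambda>_. D)) (\<lambda>s. f (s j) * g s)"
    and "(\<integral>s. f (s j) * g s \<partial>PiM UNIV (\<lambda>_. D)) = (\<integral>x. f x \<partial>D) * (\<integral>s. g s \<partial>PiM UNIV (\<lambda>_. D))"
proof -
  let ?M = "PiM UNIV (\<lambda>_::nat. D)"
  interpret O: prob_space ?M by (rule prob_space_PiM) (rule D)
  have comp: "distr ?M D (\<lambda>s. s i) = D" for i
    by (rule distr_PiM_component) (simp_all add: D)
  have coord: "O.indep_vars (\<lambda>_. D) (\<lambda>i s. s i) UNIV"
    by (subst O.indep_vars_iff_distr_eq_PiM) (simp_all add: comp restrict_def)
  have "O.indep_var (PiM {j} (\<lambda>_. D)) (\<lambda>s. restrict (\<lambda>i. s i) {j}) (PiM J (\<lambda>_. D)) (\<lambda>s. restrict (\<lambda>i. s i) J)"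
    by (rule O.indep_var_restrict[OF coord]) (use j in auto)
  moreover have "(\<lambda>x. f (x j)) \<in> borel_measurable (PiM {j} (\<lambda>_. D))"
    by (rule measurable_compose[OF _ f]) (simp add: measurable_component_singleton)
  ultimately have "O.indep_var borel ((\<lambda>x. f (x j)) \<circ> (\<lambda>s. restrict (\<lambda>i. s i) {j})) borel (g \<circ> (\<lambda>s. restrict (\<lambda>i. s i) J))"
    using g by (rule O.indep_var_compose)
  then have ind: "O.indep_var borel (\<lambda>s. f (s j)) borel g"
    by (simp add: o_def gJ)
  have fj: "integrable ?M (\<lambda>s. f (s j))"
  proof -
    have "integrable (distr ?M D (\<lambda>s. s j)) f" using intf by (simp add: comp)
    then show ?thesis by (subst (asm) integrable_distr_eq) (use f in auto)
  qed
  have "(\<integral>s. f (s j) \<partial>?M) = (\<integral>x. f x \<partial>distr ?M D (\<lambda>s. s j))"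
    by (rule integral_distr[symmetric]) (use f in auto)
  then have e: "(\<integral>s. f (s j) \<partial>?M) = (\<integral>x. f x \<partial>D)" by (simp add: comp)
  show "integrable ?M (\<lambda>s. f (s j) * g s)"
    by (rule O.indep_var_integrable[OF ind fj intg])
  show "(\<integral>s. f (s j) * g s \<partial>?M) = (\<integral>x. f x \<partial>D) * (\<integral>s. g s \<partial>?M)"
    using O.indep_var_lebesgue_integral[OF ind fj intg] by (simp add: e)
qed

lemma iterate_cong:
  "(\<And>j. 1 \<le> j \<Longrightarrow> j < k \<Longrightarrow> s j = s' j) \<Longrightarrow>
    iterate A b B \<omega> \<beta> x0 x1 s k = iterate A b B \<omega> \<beta> x0 x1 s' k"
  by (induction A b B \<omega> \<beta> x0 x1 s k rule: iterate.induct) auto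

text \<open>The reference point \<open>y\<close> is an arbitrary solution; for the rate of convergence it will be the projection of the starting point.\<close>

locale momentum_method = sketched_system m n A B R Ri D b
  for m n A B R Ri D b +
  fixes \<omega> \<beta> :: real and x0 x1 y :: "real Matrix.vec"
  assumes x0: "x0 \<in> carrier_vec n" and x1: "x1 \<in> carrier_vec n" and y: "y \<in> solutions A b"
begin

definition err :: "(nat \<Rightarrow> real mat) \<Rightarrow> nat \<Rightarrow> real Matrix.vec" where
  "err s k = Ri *\<^sub>v (iterate A b B \<omega> \<beta> x0 x1 s k - y)"

lemma y_carrier: "y \<in> carrier_vec n"
  using y by (simp add: solutions_def)

lemma err_carrier: "iterate A b B \<omega> \<beta> x0 x1 s k \<in> carrier_vec n \<Longrightarrow> err s k \<in> carrier_vec n"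
  unfolding err_def using y_carrier by (intro Ri_carrier) simp

text \<open>The second conclusion is the recursion for the whitened error. It is stated for components because expectations of vectors are taken componentwise.\<close>

lemma iterate_step:
  fixes s k
  defines "X \<equiv> iterate A b B \<omega> \<beta> x0 x1 s"
  assumes X0: "X k \<in> carrier_vec n" and X1: "X (Suc k) \<in> carrier_vec n" and S: "dim_row (s (Suc k)) = m"
  shows "X (Suc (Suc k)) \<in> carrier_vec n"
    and "i < n \<Longrightarrow> err s (Suc (Suc k)) $ i = (1 + \<beta>) * err s (Suc k) $ i - \<beta> * err s k $ i
      - \<omega> * (\<Sum>j<n. sketch_proj (s (Suc k)) $$ (i, j) * err s (Suc k) $ j)"
proof -
  define P where "P = sketch_proj (s (Suc k))"
  have P: "P \<in> carrier_mat n n" unfolding P_def by (rule sketch_proj_facts(3)[OF S])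
  define w where "w = err s (Suc k)"
  have w: "w \<in> carrier_vec n" unfolding w_def using X1 by (intro err_carrier) (simp add: X_def)
  define g where "g = R *\<^sub>v (P *\<^sub>v w)"
  have Pw: "P *\<^sub>v w \<in> carrier_vec n" using P w by simp
  have g: "g \<in> carrier_vec n" using R Pw by (simp add: g_def)
  have step: "X (Suc (Suc k)) = X (Suc k) - \<omega> \<cdot>\<^sub>v g + \<beta> \<cdot>\<^sub>v (X (Suc k) - X k)"
    using gradient_f_sample[OF S y X1] by (simp add: X_def g_def P_def w_def err_def)
  show X2: "X (Suc (Suc k)) \<in> carrier_vec n"
    unfolding step using X0 X1 g by simp
  define a where "a = X (Suc k) - y"
  define c where "c = X k - y"
  have ac: "a \<in> carrier_vec n" "c \<in> carrier_vec n" using X0 X1 y_carrier by (auto simp: a_def c_def)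
  have comp: "(X (Suc (Suc k)) - y) $ j = (1 + \<beta>) * a $ j - \<beta> * c $ j - \<omega> * g $ j" if "j < n" for j
    using that X0 X1 X2 g y_carrier unfolding step a_def c_def by (simp add: algebra_simps)
  show "err s (Suc (Suc k)) $ i = (1 + \<beta>) * err s (Suc k) $ i - \<beta> * err s k $ i
      - \<omega> * (\<Sum>j<n. sketch_proj (s (Suc k)) $$ (i, j) * err s (Suc k) $ j)" if i: "i < n"
  proof -
    have X2y: "X (Suc (Suc k)) - y \<in> carrier_vec n" using X2 y_carrier by simp
    have "err s (Suc (Suc k)) $ i = (\<Sum>j<n. Ri $$ (i, j) * (X (Suc (Suc k)) - y) $ j)"
      unfolding err_def X_def[symmetric] by (rule mult_vec_index_sum[OF Ri X2y i])
    also have "\<dots> = (\<Sum>j<n. (1 + \<beta>) * (Ri $$ (i, j) * a $ j) - \<beta> * (Ri $$ (i, j) * c $ j)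
        - \<omega> * (Ri $$ (i, j) * g $ j))"
      by (rule sum.cong) (auto simp: comp algebra_simps simp del: index_minus_vec)
    also have "\<dots> = (1 + \<beta>) * (Ri *\<^sub>v a) $ i - \<beta> * (Ri *\<^sub>v c) $ i - \<omega> * (Ri *\<^sub>v g) $ i"
      unfolding mult_vec_index_sum[OF Ri ac(1) i] mult_vec_index_sum[OF Ri ac(2) i] mult_vec_index_sum[OF Ri g i]
      by (simp add: sum_subtractf sum_distrib_left)
    also have "Ri *\<^sub>v g = P *\<^sub>v w" unfolding g_def using Pw carrier_matD[OF P] by (intro R_cancel_vec) simp
    also have "(P *\<^sub>v w) $ i = (\<Sum>j<n. P $$ (i, j) * w $ j)" by (rule mult_vec_index_sum[OF P w i])
    also have "Ri *\<^sub>v a = err s (Suc k)" by (simp add: err_def a_def X_def)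
    also have "Ri *\<^sub>v c = err s k" by (simp add: err_def c_def X_def)
    finally show ?thesis unfolding P_def w_def .
  qed
qed

lemma iterate_carrier:
  assumes "\<And>j. 1 \<le> j \<Longrightarrow> j < k \<Longrightarrow> dim_row (s j) = m"
  shows "iterate A b B \<omega> \<beta> x0 x1 s k \<in> carrier_vec n"
  using assms
proof (induction k rule: less_induct)
  case (less k)
  consider "k = 0" | "k = 1" | l where "k = Suc (Suc l)" by (metis One_nat_def not0_implies_Suc)
  then show ?case
  proof cases
    case 3
    then show ?thesis using less by (intro iterate_step(1)[of s l, folded 3]) auto
  qed (simp_all add: x0 x1)
qed

text \<open>For a fixed step the error is a bounded function of the samples, as the coefficients of the recursion are constants and entries of
projections. Measurability is proved on every product over an index set that contains the samples used so far, so
that the error can be treated as a function of the past alone when independence is invoked.\<close>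

lemma err_measurable_bounded:
  assumes "{1..<k} \<subseteq> I" and "i < n"
  shows "(\<lambda>s. err s k $ i) \<in> borel_measurable (PiM I (\<lambda>_. D)) \<and>
    (\<exists>c. \<forall>s \<in> space (PiM I (\<lambda>_. D)). \<bar>err s k $ i\<bar> \<le> c)"
  using assms
proof (induction k arbitrary: i rule: less_induct)
  case (less k)
  consider "k = 0" | "k = 1" | l where "k = Suc (Suc l)" by (metis One_nat_def not0_implies_Suc)
  then show ?case
  proof cases
    case 1
    then show ?thesis by (auto simp: err_def)
  next
    case 2
    then show ?thesis by (auto simp: err_def)
  next
    case (3 l)
    let ?M = "PiM I (\<lambda>_. D)"
    have I: "Suc l \<in> I" "{1..<Suc l} \<subseteq> I" "{1..<l} \<subseteq> I" using less.prems(1) 3 by auto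
    have dims: "dim_row (s j) = m" if "s \<in> space ?M" "1 \<le> j" "j < k" for s j
    proof -
      have "j \<in> I" using that less.prems(1) by auto
      then have "s j \<in> space D" using that(1) by (auto simp: space_PiM)
      then show ?thesis by (simp add: space_D)
    qed
    define rhs where "rhs s = (1 + \<beta>) * err s (Suc l) $ i - \<beta> * err s l $ i
      - \<omega> * (\<Sum>j<n. sketch_proj (s (Suc l)) $$ (i, j) * err s (Suc l) $ j)" for s
    have step: "err s k $ i = rhs s" if s: "s \<in> space ?M" for s
      unfolding 3 rhs_def
      by (rule iterate_step(2)) (use dims[OF s] 3 less.prems(2) in \<open>auto intro!: iterate_carrier\<close>)
    have IH1: "(\<lambda>s. err s (Suc l) $ j) \<in> borel_measurable ?M" "\<exists>c. \<forall>s \<in> space ?M. \<bar>err s (Suc l) $ j\<bar> \<le> c"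
      if "j < n" for j using less.IH[of "Suc l" j] 3 I that by auto
    have IH0: "(\<lambda>s. err s l $ j) \<in> borel_measurable ?M" "\<exists>c. \<forall>s \<in> space ?M. \<bar>err s l $ j\<bar> \<le> c"
      if "j < n" for j using less.IH[of l j] 3 I that by auto
    have meas_P: "(\<lambda>s. sketch_proj (s (Suc l)) $$ (i, j)) \<in> borel_measurable ?M" if "j < n" for j
      by (rule measurable_compose[OF measurable_component_singleton[OF I(1)] proj_measurable_D[OF less.prems(2) that]])
    have "rhs \<in> borel_measurable ?M"
      unfolding rhs_def[abs_def]
      by (intro borel_measurable_diff borel_measurable_times borel_measurable_const borel_measurable_sum
          IH1 IH0 meas_P less.prems(2)) auto
    then have meas: "(\<lambda>s. err s k $ i) \<in> borel_measurable ?M"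
      by (rule measurable_cong[THEN iffD1, rotated]) (simp add: step)
    obtain c1 where c1: "\<And>j s. j < n \<Longrightarrow> s \<in> space ?M \<Longrightarrow> \<bar>err s (Suc l) $ j\<bar> \<le> c1 j"
      using IH1(2) by metis
    obtain c0 where c0: "\<And>j s. j < n \<Longrightarrow> s \<in> space ?M \<Longrightarrow> \<bar>err s l $ j\<bar> \<le> c0 j"
      using IH0(2) by metis
    have bound: "\<bar>rhs s\<bar> \<le> \<bar>1 + \<beta>\<bar> * c1 i + \<bar>\<beta>\<bar> * c0 i + \<bar>\<omega>\<bar> * (\<Sum>j<n. c1 j)" if s: "s \<in> space ?M" for s
    proof -
      have "s (Suc l) \<in> space D" using s I(1) by (auto simp: space_PiM)
      then have P: "\<bar>sketch_proj (s (Suc l)) $$ (i, j)\<bar> \<le> 1" if "j < n" for j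
        using proj_entry_bound[OF _ less.prems(2) that] by blast
      have "\<bar>\<Sum>j<n. sketch_proj (s (Suc l)) $$ (i, j) * err s (Suc l) $ j\<bar> \<le> (\<Sum>j<n. c1 j)"
      proof (rule order_trans[OF sum_abs], rule sum_mono)
        fix j assume "j \<in> {..<n}"
        then have j: "j < n" by simp
        have "\<bar>sketch_proj (s (Suc l)) $$ (i, j)\<bar> * \<bar>err s (Suc l) $ j\<bar> \<le> 1 * c1 j"
          by (intro mult_mono P[OF j] c1[OF j s]) auto
        then show "\<bar>sketch_proj (s (Suc l)) $$ (i, j) * err s (Suc l) $ j\<bar> \<le> c1 j" by (simp add: abs_mult)
      qed
      then have "\<bar>\<omega> * (\<Sum>j<n. sketch_proj (s (Suc l)) $$ (i, j) * err s (Suc l) $ j)\<bar> \<le> \<bar>\<omega>\<bar> * (\<Sum>j<n. c1 j)"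
        by (simp add: abs_mult mult_left_mono)
      moreover have "\<bar>(1 + \<beta>) * err s (Suc l) $ i\<bar> \<le> \<bar>1 + \<beta>\<bar> * c1 i"
        using c1[OF less.prems(2) s] by (simp add: abs_mult mult_left_mono)
      moreover have "\<bar>\<beta> * err s l $ i\<bar> \<le> \<bar>\<beta>\<bar> * c0 i"
        using c0[OF less.prems(2) s] by (simp add: abs_mult mult_left_mono)
      ultimately show ?thesis unfolding rhs_def by linarith
    qed
    then show ?thesis using meas step by auto
  qed
qed

abbreviation Samples where "Samples \<equiv> PiM UNIV (\<lambda>_::nat. D)"

lemma prob_space_Samples: "prob_space Samples"
  by (rule prob_space_PiM) (rule prob_space_axioms)

lemma err_integrable:
  assumes i: "i < n"
  shows "integrable Samples (\<lambda>s. err s k $ i)"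
proof -
  interpret S: prob_space Samples by (rule prob_space_Samples)
  obtain c where "\<forall>s \<in> space Samples. \<bar>err s k $ i\<bar> \<le> c"
    using err_measurable_bounded[of k UNIV i] i by blast
  then show ?thesis
    using err_measurable_bounded[of k UNIV i] i
    by (intro S.integrable_const_bound[of _ c]) auto
qed

definition mean_err :: "nat \<Rightarrow> real Matrix.vec" where
  "mean_err k = Matrix.vec n (\<lambda>i. \<integral>s. err s k $ i \<partial>Samples)"

lemma Samples_dim: "s \<in> space Samples \<Longrightarrow> dim_row (s j) = m"
  by (auto simp: space_PiM space_D)

text \<open>The iterate \<open>k + 1\<close> depends on the samples 1 to \<open>k\<close> only, so it is independent of the next projection, and the expectation of
the product is the product of the expectations.\<close>

lemma mean_err_step:
  assumes i: "i < n"
  shows "mean_err (Suc (Suc k)) $ i = (1 + \<beta>) * mean_err (Suc k) $ i - \<beta> * mean_err k $ i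
    - \<omega> * (W *\<^sub>v mean_err (Suc k)) $ i"
proof -
  let ?P = "\<lambda>j s. sketch_proj (s (Suc k)) $$ (i, j) * err s (Suc k) $ j"
  have ind: "integrable Samples (?P j)"
    "(\<integral>s. ?P j s \<partial>Samples) = W $$ (i, j) * mean_err (Suc k) $ j" if j: "j < n" for j
  proof -
    have loc: "err (restrict s {1..<Suc k}) (Suc k) = err s (Suc k)" for s
      unfolding err_def by (rule arg_cong[OF iterate_cong]) auto
    note i1 = indep_expectation_PiM[where j = "Suc k" and J = "{1..<Suc k}"
        and f = "\<lambda>S. sketch_proj S $$ (i, j)" and g = "\<lambda>s. err s (Suc k) $ j",
        OF prob_space_axioms _ proj_measurable_D[OF i j]
          conjunct1[OF err_measurable_bounded[OF order_refl j]] _ proj_integrable[OF i j] err_integrable[OF j]]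
    show "integrable Samples (?P j)" by (rule i1(1)) (simp_all add: loc[simplified])
    have "(\<integral>s. ?P j s \<partial>Samples) = (\<integral>S. sketch_proj S $$ (i, j) \<partial>D) * (\<integral>s. err s (Suc k) $ j \<partial>Samples)"
      by (rule i1(2)) (simp_all add: loc[simplified])
    then show "(\<integral>s. ?P j s \<partial>Samples) = W $$ (i, j) * mean_err (Suc k) $ j"
      using i j by (simp add: expect_mat_def mean_err_def)
  qed
  have "mean_err (Suc (Suc k)) $ i = (\<integral>s. err s (Suc (Suc k)) $ i \<partial>Samples)"
    using i by (simp add: mean_err_def)
  also have "\<dots> = (\<integral>s. (1 + \<beta>) * err s (Suc k) $ i - \<beta> * err s k $ i - \<omega> * (\<Sum>j<n. ?P j s) \<partial>Samples)"
    by (rule Bochner_Integration.integral_cong[OF refl], rule iterate_step(2))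
      (use i Samples_dim in \<open>auto intro!: iterate_carrier\<close>)
  also have "\<dots> = (1 + \<beta>) * mean_err (Suc k) $ i - \<beta> * mean_err k $ i - \<omega> * (\<Sum>j<n. W $$ (i, j) * mean_err (Suc k) $ j)"
  proof -
    have sum: "integrable Samples (\<lambda>s. \<Sum>j<n. ?P j s)"
      by (rule Bochner_Integration.integrable_sum) (use ind in auto)
    have "(\<integral>s. (\<Sum>j<n. ?P j s) \<partial>Samples) = (\<Sum>j<n. \<integral>s. ?P j s \<partial>Samples)"
      by (rule Bochner_Integration.integral_sum) (use ind in auto)
    also have "\<dots> = (\<Sum>j<n. W $$ (i, j) * mean_err (Suc k) $ j)"
      by (rule sum.cong) (use ind in auto)
    finally have S: "(\<integral>s. (\<Sum>j<n. ?P j s) \<partial>Samples) = (\<Sum>j<n. W $$ (i, j) * mean_err (Suc k) $ j)" .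
    have a: "integrable Samples (\<lambda>s. (1 + \<beta>) * err s (Suc k) $ i)" "integrable Samples (\<lambda>s. \<beta> * err s k $ i)"
      "integrable Samples (\<lambda>s. \<omega> * (\<Sum>j<n. ?P j s))"
      using err_integrable[OF i] sum by (intro integrable_mult_right; blast)+
    show ?thesis
      unfolding Bochner_Integration.integral_diff[OF Bochner_Integration.integrable_diff[OF a(1,2)] a(3)]
        Bochner_Integration.integral_diff[OF a(1,2)] integral_mult_right_zero S
      using i by (simp add: mean_err_def)
  qed
  also have "(\<Sum>j<n. W $$ (i, j) * mean_err (Suc k) $ j) = (W *\<^sub>v mean_err (Suc k)) $ i"
    by (rule mult_vec_index_sum[symmetric, OF expect_mat_carrier _ i]) (simp add: mean_err_def)
  finally show ?thesis .
qed

lemma mean_err_initial: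
  assumes "k \<le> 1"
  shows "mean_err k = Ri *\<^sub>v ((if k = 0 then x0 else x1) - y)"
proof -
  interpret S: prob_space Samples by (rule prob_space_Samples)
  have e: "err s k = Ri *\<^sub>v ((if k = 0 then x0 else x1) - y)" for s
    using assms by (cases k) (auto simp: err_def)
  show ?thesis
    unfolding mean_err_def e by (intro eq_vecI) (simp_all add: S.prob_space del: index_mult_mat_vec)
qed

lemma norm_expected_error:
  "(norm_B B (expect_vec Samples n (\<lambda>s. iterate A b B \<omega> \<beta> x0 x1 s k - y)))\<^sup>2 = mean_err k \<bullet> mean_err k"
proof -
  define E where "E = expect_vec Samples n (\<lambda>s. iterate A b B \<omega> \<beta> x0 x1 s k - y)"
  have mc: "mean_err k \<in> carrier_vec n" by (simp add: mean_err_def)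
  have "E = R *\<^sub>v mean_err k"
  proof (rule eq_vecI)
    fix i assume "i < dim_vec (R *\<^sub>v mean_err k)"
    then have i: "i < n" by simp
    have "E $ i = (\<integral>s. (iterate A b B \<omega> \<beta> x0 x1 s k - y) $ i \<partial>Samples)"
      using i by (simp add: E_def expect_vec_def)
    also have "\<dots> = (\<integral>s. (\<Sum>j<n. R $$ (i, j) * err s k $ j) \<partial>Samples)"
    proof (rule Bochner_Integration.integral_cong[OF refl])
      fix s assume s: "s \<in> space Samples"
      have x: "iterate A b B \<omega> \<beta> x0 x1 s k \<in> carrier_vec n"
        by (rule iterate_carrier) (rule Samples_dim[OF s])
      have "iterate A b B \<omega> \<beta> x0 x1 s k - y = R *\<^sub>v err s k"
        unfolding err_def using x y_carrier by (intro R_cancel_vec(1)[symmetric]) simp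
      then show "(iterate A b B \<omega> \<beta> x0 x1 s k - y) $ i = (\<Sum>j<n. R $$ (i, j) * err s k $ j)"
        using mult_vec_index_sum[OF R err_carrier[OF x] i] by simp
    qed
    also have "\<dots> = (\<Sum>j<n. \<integral>s. R $$ (i, j) * err s k $ j \<partial>Samples)"
      using err_integrable by (intro Bochner_Integration.integral_sum integrable_mult_right) auto
    also have "\<dots> = (\<Sum>j<n. R $$ (i, j) * mean_err k $ j)"
      unfolding integral_mult_right_zero by (simp add: mean_err_def)
    also have "\<dots> = (R *\<^sub>v mean_err k) $ i" by (rule mult_vec_index_sum[OF R mc i, symmetric])
    finally show "E $ i = (R *\<^sub>v mean_err k) $ i" .
  qed (simp add: E_def expect_vec_def)
  moreover have "R *\<^sub>v mean_err k \<in> carrier_vec n" using R mc by simp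
  ultimately have "(norm_B B E)\<^sup>2 = mean_err k \<bullet> mean_err k"
    using mc scalar_prod_self_nonneg[of "mean_err k"] by (simp add: norm_B_whitened R_cancel_vec)
  then show ?thesis unfolding E_def .
qed

end

section \<open>Geometric decay\<close>

text \<open>The quadratic form \<open>Q\<close> in two consecutive terms is multiplied by \<open>\<beta>\<close> in each step. Completing the square
shows \<open>Q k \<ge> (\<beta> - t\<^sup>2 / 4) a\<^sub>k\<^sup>2\<close>, with a positive factor by the assumption on the discriminant.\<close>

lemma momentum_recursion_bound:
  fixes a :: "nat \<Rightarrow> real"
  assumes rec: "\<And>k. a (Suc (Suc k)) = t * a (Suc k) - \<beta> * a k" and disc: "t\<^sup>2 < 4 * \<beta>"
  shows "\<exists>C\<ge>0. \<forall>k. (a k)\<^sup>2 \<le> C * \<beta> ^ k"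
proof -
  define Q where "Q k = (a (Suc k))\<^sup>2 - t * a (Suc k) * a k + \<beta> * (a k)\<^sup>2" for k
  have "Q (Suc k) = \<beta> * Q k" for k
    by (simp add: Q_def rec power2_eq_square algebra_simps)
  then have Q: "Q k = \<beta> ^ k * Q 0" for k
    by (induction k) simp_all
  define \<delta> where "\<delta> = \<beta> - t\<^sup>2 / 4"
  have \<delta>: "\<delta> > 0" using disc by (simp add: \<delta>_def)
  have "Q k = (a (Suc k) - t / 2 * a k)\<^sup>2 + \<delta> * (a k)\<^sup>2" for k
    by (simp add: Q_def \<delta>_def power2_eq_square field_simps)
  then have low: "\<delta> * (a k)\<^sup>2 \<le> Q k" for k by simp
  have "Q 0 \<ge> 0" using low[of 0] \<delta> by (meson mult_nonneg_nonneg order_trans less_imp_le zero_le_power2)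
  moreover have "(a k)\<^sup>2 \<le> Q 0 / \<delta> * \<beta> ^ k" for k
    using low[of k] \<delta> unfolding Q[of k] by (simp add: field_simps)
  ultimately show ?thesis using \<delta> by (intro exI[of _ "Q 0 / \<delta>"]) simp
qed

text \<open>With \<open>p = \<omega> d\<close> and \<open>s = sqrt \<beta>\<close> the claim is \<open>|1 + s\<^sup>2 - p| < 2 s\<close>. The upper bound is \<open>(1 - s)\<^sup>2 < p\<close>, which
is what the lower bound on \<open>\<beta>\<close> gives; the lower bound holds because \<open>p \<le> 1\<close>.\<close>

lemma momentum_discriminant:
  fixes \<omega> \<beta> l d u :: real
  assumes \<omega>: "0 < \<omega>" "\<omega> \<le> 1 / u" and l: "0 < l" "l \<le> d" "d \<le> u"
    and \<beta>: "(1 - sqrt (\<omega> * l))\<^sup>2 < \<beta>" "\<beta> < 1"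
  shows "(1 + \<beta> - \<omega> * d)\<^sup>2 < 4 * \<beta>"
proof -
  define s where "s = sqrt \<beta>"
  define p where "p = \<omega> * d"
  have \<beta>0: "\<beta> > 0" using \<beta>(1) by (meson order_le_less_trans zero_le_power2)
  then have s: "s > 0" "s < 1" "\<beta> = s\<^sup>2" using \<beta>(2) by (auto simp: s_def)
  have u: "u > 0" using l by linarith
  have "p \<le> \<omega> * u" unfolding p_def using \<omega>(1) l(3) by (intro mult_left_mono) auto
  also have "\<dots> \<le> 1" using \<omega>(2) u by (simp add: field_simps)
  finally have p1: "p \<le> 1" .
  have lp: "\<omega> * l \<le> p" unfolding p_def using \<omega>(1) l(2) by (intro mult_left_mono) auto
  then have "sqrt (\<omega> * l) \<le> sqrt p" by simp
  moreover have "1 - sqrt (\<omega> * l) < s"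
    using \<beta>(1) unfolding s(3) by (rule power2_less_imp_less) (use s in simp)
  ultimately have "1 - s < sqrt p" by linarith
  then have "(1 - s)\<^sup>2 < (sqrt p)\<^sup>2" using s by (intro power_strict_mono) auto
  moreover have "p \<ge> 0" using \<omega>(1) l by (simp add: p_def)
  ultimately have "(1 - s)\<^sup>2 < p" by simp
  then have "1 + \<beta> - p < 2 * s" using s(3) by (simp add: power2_eq_square algebra_simps)
  moreover have "- (2 * s) < 1 + \<beta> - p" using p1 \<beta>0 s(1) by linarith
  ultimately have "\<bar>1 + \<beta> - p\<bar> < 2 * s" by linarith
  then have "\<bar>1 + \<beta> - p\<bar>\<^sup>2 < (2 * s)\<^sup>2" by (intro power_strict_mono) auto
  then show ?thesis by (simp add: p_def s(3))
qed

text \<open>From \<open>1 - \<tau> \<le> exp (- \<tau>)\<close> the rate is at most \<open>exp (- 2 \<tau>)\<close>, so \<open>ln (C / \<epsilon>) / (2 \<tau>)\<close> steps suffice.\<close>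

lemma complexity_of_geometric_decay:
  assumes \<tau>: "0 < \<tau>" "\<tau> \<le> 1" and T: "1 / 2 \<le> \<tau> * T"
    and err: "\<And>k. err k \<le> ((1 - \<tau>)\<^sup>2) ^ k * C"
  shows "complexity_with 1 T ((1 - \<tau>)\<^sup>2) C err"
  unfolding complexity_with_def
proof (intro allI impI)
  fix \<epsilon> :: real and k :: nat
  assume \<epsilon>: "0 < \<epsilon>" "\<epsilon> < C" and k: "1 * T * ln (C / \<epsilon>) \<le> real k"
  have ln: "ln (C / \<epsilon>) > 0" using \<epsilon> by simp
  have "ln (C / \<epsilon>) \<le> 2 * (\<tau> * T) * ln (C / \<epsilon>)" using T ln by simp
  also have "\<dots> = 2 * \<tau> * (T * ln (C / \<epsilon>))" by simp
  also have "\<dots> \<le> 2 * \<tau> * real k" using k \<tau> by (intro mult_left_mono) auto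
  finally have le: "ln (C / \<epsilon>) \<le> 2 * \<tau> * real k" .
  have "1 - \<tau> \<le> exp (- \<tau>)" using exp_ge_add_one_self[of "- \<tau>"] by simp
  then have "(1 - \<tau>) ^ (2 * k) \<le> exp (- \<tau>) ^ (2 * k)" using \<tau> by (intro power_mono) auto
  also have "\<dots> = exp (- (2 * \<tau> * real k))" by (simp flip: exp_of_nat_mult)
  also have "\<dots> \<le> exp (- ln (C / \<epsilon>))" using le by simp
  also have "\<dots> = \<epsilon> / C" using \<epsilon> by (simp add: exp_minus)
  finally have "((1 - \<tau>)\<^sup>2) ^ k \<le> \<epsilon> / C" by (simp add: power_mult)
  then have "((1 - \<tau>)\<^sup>2) ^ k * C \<le> \<epsilon>" using \<epsilon> by (simp add: field_simps)
  then show "((1 - \<tau>)\<^sup>2) ^ k * C \<le> \<epsilon> \<and> err k \<le> \<epsilon>" using err[of k] by linarith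
qed

context sketched_system
begin

lemma W_eigenvalue_range:
  assumes "eigenvalue W e"
  shows "0 \<le> e" "e \<le> 1"
proof -
  have dW: "dim_row W = n" by (simp add: expect_mat_def)
  obtain v where v: "v \<in> carrier_vec n" "v \<noteq> 0\<^sub>v n" "W *\<^sub>v v = e \<cdot>\<^sub>v v"
    using assms by (auto simp: eigenvalue_def eigenvector_def dW)
  have pos: "v \<bullet> v > 0" by (rule scalar_prod_self_pos[OF v(1,2)])
  have "v \<bullet> (W *\<^sub>v v) = e * (v \<bullet> v)" using v by simp
  then show "0 \<le> e" "e \<le> 1"
    using W_quadratic_form[OF v(1)] pos by (simp_all add: zero_le_mult_iff)
qed

lemma eigenvalue_bounds:
  assumes W: "W \<noteq> 0\<^sub>m n n"
  shows "0 < lambda_min_nz W" "lambda_min_nz W \<le> lambda_max W" "lambda_max W \<le> 1"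
    and "\<And>e. eigenvalue W e \<Longrightarrow> e \<noteq> 0 \<Longrightarrow> lambda_min_nz W \<le> e \<and> e \<le> lambda_max W"
proof -
  have Wc: "W \<in> carrier_mat n n" by simp
  have fin: "finite {l. eigenvalue W l}"
    using card_finite_spectrum(1)[OF Wc] by (simp add: spectrum_def)
  obtain U d where U: "orthogonal_matrix n U" and Wd: "W = spectral_mat n U d"
    using real_spectral_theorem[OF Wc W_symmetric] .
  interpret orthogonal_matrix n U by (rule U)
  have "\<exists>k<n. d k \<noteq> 0"
  proof (rule ccontr)
    assume "\<not> ?thesis"
    then have "W = 0\<^sub>m n n" unfolding Wd by (intro eq_matI) (simp_all add: spectral_index)
    then show False using W by simp
  qed
  then obtain k where k: "k < n" "d k \<noteq> 0" by blast
  have ev: "eigenvalue W (d k)" unfolding Wd by (rule spectral_eigenvalue[OF k(1)])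
  let ?E = "{l. eigenvalue W l \<and> l \<noteq> 0}"
  have finE: "finite ?E" using fin by (rule finite_subset[rotated]) auto
  have ne: "?E \<noteq> {}" using ev k by blast
  have minE: "lambda_min_nz W \<in> ?E" unfolding lambda_min_nz_def by (rule Min_in[OF finE ne])
  then show "0 < lambda_min_nz W" using W_eigenvalue_range(1)[of "lambda_min_nz W"] by auto
  show *: "lambda_min_nz W \<le> e \<and> e \<le> lambda_max W" if "eigenvalue W e" "e \<noteq> 0" for e
    unfolding lambda_min_nz_def lambda_max_def using that fin finE by (auto intro!: Min_le Max_ge)
  show "lambda_min_nz W \<le> lambda_max W" using *[of "lambda_min_nz W"] minE by simp
  have "lambda_max W \<in> {l. eigenvalue W l}" unfolding lambda_max_def
    by (rule Max_in[OF fin]) (use ev in blast)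
  then show "lambda_max W \<le> 1" using W_eigenvalue_range(2) by simp
qed

text \<open>The components in the eigenvectors of \<open>W\<close> obey scalar recursions. Those for the eigenvalue zero vanish identically, since the
eigenvector is orthogonal to both starting errors; the others decay at the rate \<open>\<beta>\<close>.\<close>

lemma mean_error_decay:
  assumes W: "W \<noteq> 0\<^sub>m n n" and exact: "exactness A b B D"
    and x0: "x0 \<in> carrier_vec n" and x1: "x1 \<in> carrier_vec n"
    and start: "x0 - x1 \<in> mat_range (mat_inv B * A\<^sup>T)"
    and \<omega>: "0 < \<omega>" "\<omega> \<le> 1 / lambda_max W"
    and \<beta>: "(1 - sqrt (\<omega> * lambda_min_nz W))\<^sup>2 < \<beta>" "\<beta> < 1"
  shows "\<exists>C>0. \<forall>k. mean_error_sq A b B D \<omega> \<beta> x0 x1 k \<le> \<beta> ^ k * C"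
proof -
  define y where "y = proj_B B (solutions A b) x0"
  note proj = projection_onto_solutions[OF x0 b consistent, folded y_def]
  interpret mm: momentum_method m n A B R Ri D b \<omega> \<beta> x0 x1 y
    by unfold_locales (rule x0 x1 proj(1))+
  have yc: "y \<in> carrier_vec n" by (rule mm.y_carrier)
  have mc: "mm.mean_err k \<in> carrier_vec n" for k by (simp add: mm.mean_err_def)
  have error: "mean_error_sq A b B D \<omega> \<beta> x0 x1 k = mm.mean_err k \<bullet> mm.mean_err k" for k
    using mm.norm_expected_error[of k] by (simp add: mean_error_sq_def y_def[symmetric])
  have Wc: "W \<in> carrier_mat n n" by simp
  obtain U d where U: "orthogonal_matrix n U" and Wd: "W = spectral_mat n U d"
    using real_spectral_theorem[OF Wc W_symmetric] .
  interpret orthogonal_matrix n U by (rule U)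
  define a where "a l k = col U l \<bullet> mm.mean_err k" for l k
  have cc: "col U l \<in> carrier_vec n" for l by (rule carrier_vecI) simp
  have rec: "a l (Suc (Suc k)) = (1 + \<beta> - \<omega> * d l) * a l (Suc k) - \<beta> * a l k" if l: "l < n" for l k
  proof -
    have WM: "W *\<^sub>v mm.mean_err (Suc k) \<in> carrier_vec n" using Wc mc by (rule mult_mat_vec_carrier)
    have "a l (Suc (Suc k)) = (\<Sum>i<n. col U l $ i * mm.mean_err (Suc (Suc k)) $ i)"
      unfolding a_def using mc[of "Suc (Suc k)"] by (intro scalar_prod_sum) simp
    also have "\<dots> = (\<Sum>i<n. (1 + \<beta>) * (col U l $ i * mm.mean_err (Suc k) $ i)
        - \<beta> * (col U l $ i * mm.mean_err k $ i) - \<omega> * (col U l $ i * (W *\<^sub>v mm.mean_err (Suc k)) $ i))"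
    proof (rule sum.cong[OF refl])
      fix i assume "i \<in> {..<n}"
      then have i: "i < n" by simp
      show "col U l $ i * mm.mean_err (Suc (Suc k)) $ i = (1 + \<beta>) * (col U l $ i * mm.mean_err (Suc k) $ i)
        - \<beta> * (col U l $ i * mm.mean_err k $ i) - \<omega> * (col U l $ i * (W *\<^sub>v mm.mean_err (Suc k)) $ i)"
        unfolding mm.mean_err_step[OF i] by (simp add: algebra_simps del: index_mult_mat_vec index_col)
    qed
    also have "\<dots> = (1 + \<beta>) * a l (Suc k) - \<beta> * a l k - \<omega> * (col U l \<bullet> (W *\<^sub>v mm.mean_err (Suc k)))"
      unfolding a_def scalar_prod_sum[OF carrier_vecD[OF mc]] scalar_prod_sum[OF carrier_vecD[OF WM]]
      by (simp add: sum_subtractf sum_distrib_left del: index_mult_mat_vec index_col)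
    also have "col U l \<bullet> (W *\<^sub>v mm.mean_err (Suc k)) = (W *\<^sub>v col U l) \<bullet> mm.mean_err (Suc k)"
      using scalar_prod_transpose_dim[of "col U l" W "mm.mean_err (Suc k)"] mc[of "Suc k"]
      by (simp add: W_symmetric carrier_matD[OF Wc])
    also have "\<dots> = d l * a l (Suc k)"
      unfolding Wd spectral_mult_col[OF l] a_def using cc mc[of "Suc k"] by simp
    finally show ?thesis by (simp add: algebra_simps)
  qed
  have bound: "\<exists>C\<ge>0. \<forall>k. (a l k)\<^sup>2 \<le> C * \<beta> ^ k" if l: "l < n" for l
  proof (cases "d l = 0")
    case True
    have "W *\<^sub>v col U l = 0\<^sub>v n" unfolding Wd spectral_mult_col[OF l] True by (intro eq_vecI) auto
    from exactness_kernel[OF exact cc this] have ker: "A *\<^sub>v (R *\<^sub>v col U l) = 0\<^sub>v m" .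
    have orth: "col U l \<bullet> (R *\<^sub>v (A\<^sup>T *\<^sub>v u)) = 0" if u: "u \<in> carrier_vec m" for u
    proof -
      have "col U l \<bullet> (R *\<^sub>v (A\<^sup>T *\<^sub>v u)) = (R *\<^sub>v col U l) \<bullet> (A\<^sup>T *\<^sub>v u)"
        using scalar_prod_transpose_dim[of "col U l" R "A\<^sup>T *\<^sub>v u"] by (simp add: Rt)
      also have "\<dots> = (A *\<^sub>v (R *\<^sub>v col U l)) \<bullet> u"
        using scalar_prod_transpose_dim[of "R *\<^sub>v col U l" "A\<^sup>T" u] u by simp
      finally show ?thesis using u by (simp add: ker)
    qed
    obtain u where u: "u \<in> carrier_vec m" "Ri *\<^sub>v (x0 - y) = R *\<^sub>v (A\<^sup>T *\<^sub>v u)" using proj(2) by blast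
    obtain u' where u': "u' \<in> carrier_vec m" "x0 - x1 = mat_inv B * A\<^sup>T *\<^sub>v u'"
      using start by (auto simp: mat_range_def)
    have Ri01: "Ri *\<^sub>v (x0 - x1) = R *\<^sub>v (A\<^sup>T *\<^sub>v u')"
      using u'(1) unfolding u'(2) inv_B by (simp add: mult_vec_assoc_dim R_cancel_vec)
    have a0: "a l 0 = 0" using orth[OF u(1)] by (simp add: a_def mm.mean_err_initial u(2))
    have "x1 - y = (x0 - y) - (x0 - x1)" using x0 x1 yc by (intro eq_vecI) auto
    then have "Ri *\<^sub>v (x1 - y) = R *\<^sub>v (A\<^sup>T *\<^sub>v u) - R *\<^sub>v (A\<^sup>T *\<^sub>v u')"
      using x0 x1 yc by (simp add: Ri_diff u(2) Ri01)
    moreover have "R *\<^sub>v (A\<^sup>T *\<^sub>v w) \<in> carrier_vec n" for w by (rule carrier_vecI) simp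
    ultimately have a1: "a l (Suc 0) = 0"
      using orth[OF u(1)] orth[OF u'(1)] cc[of l]
      by (simp add: a_def mm.mean_err_initial scalar_prod_minus_distrib[of _ n])
    have "a l k = 0 \<and> a l (Suc k) = 0" for k
      by (induction k) (use a0 a1 rec[OF l] in auto)
    then show ?thesis by (intro exI[of _ 0]) simp
  next
    case False
    have "eigenvalue W (d l)" unfolding Wd by (rule spectral_eigenvalue[OF l])
    note dl = eigenvalue_bounds(4)[OF W this False]
    have "(1 + \<beta> - \<omega> * d l)\<^sup>2 < 4 * \<beta>"
      by (rule momentum_discriminant[OF \<omega> eigenvalue_bounds(1)[OF W] _ _ \<beta>]) (use dl in auto)
    then show ?thesis by (rule momentum_recursion_bound[where a = "a l", OF rec[OF l]])
  qed
  then obtain C where C: "\<And>l. l < n \<Longrightarrow> C l \<ge> 0" "\<And>l k. l < n \<Longrightarrow> (a l k)\<^sup>2 \<le> C l * \<beta> ^ k" by metis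
  have \<beta>0: "\<beta> > 0" using \<beta>(1) by (meson order_le_less_trans zero_le_power2)
  have "mean_error_sq A b B D \<omega> \<beta> x0 x1 k \<le> \<beta> ^ k * ((\<Sum>l<n. C l) + 1)" for k
  proof -
    have coord: "(U\<^sup>T *\<^sub>v mm.mean_err k) $ l = a l k" if "l < n" for l
      using that by (simp add: a_def)
    have "mean_error_sq A b B D \<omega> \<beta> x0 x1 k = (\<Sum>l<n. (a l k)\<^sup>2)"
      unfolding error norm_coordinates[OF mc] by (simp add: coord del: index_mult_mat_vec)
    also have "\<dots> \<le> (\<Sum>l<n. C l * \<beta> ^ k)" by (intro sum_mono C(2)) simp
    also have "\<dots> \<le> \<beta> ^ k * ((\<Sum>l<n. C l) + 1)"
      using \<beta>0 by (simp add: sum_distrib_right[symmetric] algebra_simps)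
    finally show ?thesis .
  qed
  \<comment> \<open>the summand 1 keeps the constant positive even if all bounds \<open>C l\<close> are zero\<close>
  moreover have "(\<Sum>l<n. C l) + 1 > 0" using C(1) by (intro add_nonneg_pos sum_nonneg) auto
  ultimately show ?thesis by blast
qed

end

text \<open>In the second conclusion \<open>\<tau> = sqrt (0.99 \<omega> lmin)\<close> plays the role of the gap \<open>1 - sqrt \<beta>\<close>. The factor 0.99 makes the lower bound
on \<open>\<beta>\<close> strict, and \<open>\<tau> sqrt (1 / (\<omega> lmin)) = sqrt 0.99\<close> exceeds 1/2, so the constant in the complexity is 1. The two special
cases of the theorem are \<open>\<omega> = 1\<close>, admissible because \<open>lmax \<le> 1\<close>, and \<open>\<omega> = 1 / lmax\<close>.\<close>

lemma momentum_convergence_and_complexity: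
  assumes A: "A \<in> carrier_mat m n" and b: "b \<in> carrier_vec m" and cons: "solutions A b \<noteq> {}"
    and B: "B \<in> carrier_mat n n" "sym_pos_def B"
    and D: "prob_space D" "sets D = sets (mat_space m)"
    and W: "W_mat A B D \<noteq> 0\<^sub>m n n"
    and lmin: "lmin = lambda_min_nz (W_mat A B D)" and lmax: "lmax = lambda_max (W_mat A B D)"
    and exact: "exactness A b B D"
    and x0: "x0 \<in> carrier_vec n" and x1: "x1 \<in> carrier_vec n"
    and start: "x0 - x1 \<in> mat_range (mat_inv B * A\<^sup>T)"
  shows "0 < \<omega> \<Longrightarrow> \<omega> \<le> 1 / lmax \<Longrightarrow> (1 - sqrt (\<omega> * lmin))\<^sup>2 < \<beta> \<Longrightarrow> \<beta> < 1 \<Longrightarrow>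
      \<exists>C>0. \<forall>k. mean_error_sq A b B D \<omega> \<beta> x0 x1 k \<le> \<beta> ^ k * C"
    and "0 < \<omega> \<Longrightarrow> \<omega> \<le> 1 / lmax \<Longrightarrow> \<beta> = (1 - sqrt (0.99 * (\<omega> * lmin)))\<^sup>2 \<Longrightarrow>
      \<exists>C>0. (\<forall>k. mean_error_sq A b B D \<omega> \<beta> x0 x1 k \<le> \<beta> ^ k * C) \<and>
        complexity_with 1 (sqrt (1 / (\<omega> * lmin))) \<beta> C (mean_error_sq A b B D \<omega> \<beta> x0 x1)"
    and "0 < lmin" "0 < lmax" "lmax \<le> 1"
proof -
  obtain R Ri where R: "R \<in> carrier_mat n n" "Ri \<in> carrier_mat n n" "R\<^sup>T = R" "Ri\<^sup>T = Ri"
    "R * Ri = 1\<^sub>m n" "Ri * R = 1\<^sub>m n" "mat_inv B = R * R" "B = Ri * Ri" "mat_sqrt (mat_inv B) = R"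
    using pos_def_whitening[OF B] .
  interpret P: prob_space D by (rule D)
  interpret sketched_system m n A B R Ri D b
    by unfold_locales (rule A b cons D R)+
  note W' = W[unfolded W_mat_eq]
  note eb = eigenvalue_bounds[OF W', folded W_mat_eq, folded lmin lmax]
  show l: "0 < lmin" "0 < lmax" "lmax \<le> 1" using eb by linarith+
  note decay = mean_error_decay[OF W' exact x0 x1 start, folded W_mat_eq, folded lmin lmax]
  show "\<exists>C>0. \<forall>k. mean_error_sq A b B D \<omega> \<beta> x0 x1 k \<le> \<beta> ^ k * C"
    if "0 < \<omega>" "\<omega> \<le> 1 / lmax" "(1 - sqrt (\<omega> * lmin))\<^sup>2 < \<beta>" "\<beta> < 1"
    using decay that by blast
  show "\<exists>C>0. (\<forall>k. mean_error_sq A b B D \<omega> \<beta> x0 x1 k \<le> \<beta> ^ k * C) \<and>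
        complexity_with 1 (sqrt (1 / (\<omega> * lmin))) \<beta> C (mean_error_sq A b B D \<omega> \<beta> x0 x1)"
    if \<omega>: "0 < \<omega>" "\<omega> \<le> 1 / lmax" and \<beta>: "\<beta> = (1 - sqrt (0.99 * (\<omega> * lmin)))\<^sup>2"
  proof -
    define p where "p = \<omega> * lmin"
    define \<tau> where "\<tau> = sqrt (0.99 * p)"
    have p0: "p > 0" using \<omega> l by (simp add: p_def)
    have "p \<le> \<omega> * lmax" unfolding p_def using \<omega> eb by (intro mult_left_mono) auto
    also have "\<dots> \<le> 1" using \<omega> l by (simp add: field_simps)
    finally have p1: "p \<le> 1" .
    have \<tau>p: "0 < \<tau>" "\<tau> < sqrt p" using p0 by (auto simp: \<tau>_def)
    have sp: "sqrt p \<le> 1" using p1 by simp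
    have \<tau>1: "\<tau> \<le> 1" using \<tau>p sp by linarith
    have "(1 - sqrt p)\<^sup>2 < (1 - \<tau>)\<^sup>2" using \<tau>p sp by (intro power_strict_mono) auto
    moreover have "(1 - \<tau>)\<^sup>2 < 1\<^sup>2" using \<tau>p \<tau>1 by (intro power_strict_mono) auto
    ultimately obtain C where C: "C > 0" "\<And>k. mean_error_sq A b B D \<omega> \<beta> x0 x1 k \<le> \<beta> ^ k * C"
      using decay[OF \<omega>, of \<beta>] \<beta> by (auto simp: p_def \<tau>_def)
    have "\<tau> * sqrt (1 / p) = sqrt (0.99 * p * (1 / p))" unfolding \<tau>_def by (simp only: real_sqrt_mult)
    also have "\<dots> = sqrt 0.99" using p0 by simp
    also have "\<dots> \<ge> 1 / 2" by (rule real_le_rsqrt) (simp add: power2_eq_square)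
    finally have T: "1 / 2 \<le> \<tau> * sqrt (1 / p)" .
    have \<beta>': "\<beta> = (1 - \<tau>)\<^sup>2" by (simp add: \<beta> \<tau>_def p_def)
    have "complexity_with 1 (sqrt (1 / p)) ((1 - \<tau>)\<^sup>2) C (mean_error_sq A b B D \<omega> \<beta> x0 x1)"
      by (rule complexity_of_geometric_decay[OF \<tau>p(1) \<tau>1 T]) (use C(2) \<beta>' in simp)
    then show ?thesis using C by (auto simp: \<beta>' p_def)
  qed
qed

theorem theorem4:
  shows "\<exists>c::real. c > 0 \<and>
    (\<forall>(m::nat) (n::nat) (A::real mat) (b::real Matrix.vec) (B::real mat) (D::real mat measure)
        (x0::real Matrix.vec) (x1::real Matrix.vec) (lmin::real) (lmax::real).
      A \<in> carrier_mat m n \<and> b \<in> carrier_vec m \<and> solutions A b \<noteq> {} \<and>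
      B \<in> carrier_mat n n \<and> sym_pos_def B \<and>
      prob_space D \<and> sets D = sets (mat_space m) \<and>
      W_mat A B D \<noteq> 0\<^sub>m n n \<and>
      lmin = lambda_min_nz (W_mat A B D) \<and> lmax = lambda_max (W_mat A B D) \<and>
      exactness A b B D \<and>
      x0 \<in> carrier_vec n \<and> x1 \<in> carrier_vec n \<and> x0 - x1 \<in> mat_range (mat_inv B * A\<^sup>T)
      \<longrightarrow>
      (\<forall>\<omega> \<beta>. 0 < \<omega> \<and> \<omega> \<le> 1 / lmax \<and> (1 - sqrt (\<omega> * lmin))\<^sup>2 < \<beta> \<and> \<beta> < 1 \<longrightarrow>
        (\<exists>C>0. \<forall>k. mean_error_sq A b B D \<omega> \<beta> x0 x1 k \<le> \<beta> ^ k * C)) \<and>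
      (\<forall>\<omega> \<beta>. \<omega> = 1 \<and> \<beta> = (1 - sqrt (0.99 * lmin))\<^sup>2 \<longrightarrow>
        (\<exists>C>0. (\<forall>k. mean_error_sq A b B D \<omega> \<beta> x0 x1 k \<le> \<beta> ^ k * C) \<and>
          complexity_with c (sqrt (1 / lmin)) \<beta> C (mean_error_sq A b B D \<omega> \<beta> x0 x1))) \<and>
      (\<forall>\<omega> \<beta>. \<omega> = 1 / lmax \<and> \<beta> = (1 - sqrt (0.99 * lmin / lmax))\<^sup>2 \<longrightarrow>
        (\<exists>C>0. (\<forall>k. mean_error_sq A b B D \<omega> \<beta> x0 x1 k \<le> \<beta> ^ k * C) \<and>
          complexity_with c (sqrt (lmax / lmin)) \<beta> C (mean_error_sq A b B D \<omega> \<beta> x0 x1))))"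
proof (rule exI[of _ 1], intro conjI zero_less_one allI impI; (elim conjE)?)
  fix m n A b B D x0 x1 lmin lmax \<omega> \<beta>
  assume a: "A \<in> carrier_mat m n" "b \<in> carrier_vec m" "solutions A b \<noteq> {}"
    "B \<in> carrier_mat n n" "sym_pos_def B" "prob_space D" "sets D = sets (mat_space m)"
    "W_mat A B D \<noteq> 0\<^sub>m n n" "lmin = lambda_min_nz (W_mat A B D)" "lmax = lambda_max (W_mat A B D)"
    "exactness A b B D" "x0 \<in> carrier_vec n" "x1 \<in> carrier_vec n"
    "x0 - x1 \<in> mat_range (mat_inv B * A\<^sup>T)"
  note main = momentum_convergence_and_complexity[OF a]
  show "\<exists>C>0. \<forall>k. mean_error_sq A b B D \<omega> \<beta> x0 x1 k \<le> \<beta> ^ k * C"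
    if "0 < \<omega>" "\<omega> \<le> 1 / lmax" "(1 - sqrt (\<omega> * lmin))\<^sup>2 < \<beta>" "\<beta> < 1"
    using main(1) that .
  show "\<exists>C>0. (\<forall>k. mean_error_sq A b B D \<omega> \<beta> x0 x1 k \<le> \<beta> ^ k * C) \<and>
      complexity_with 1 (sqrt (1 / lmin)) \<beta> C (mean_error_sq A b B D \<omega> \<beta> x0 x1)"
    if "\<omega> = 1" "\<beta> = (1 - sqrt (0.99 * lmin))\<^sup>2"
    using main(2)[of 1 \<beta>] main(3-5) that by simp
  show "\<exists>C>0. (\<forall>k. mean_error_sq A b B D \<omega> \<beta> x0 x1 k \<le> \<beta> ^ k * C) \<and>
      complexity_with 1 (sqrt (lmax / lmin)) \<beta> C (mean_error_sq A b B D \<omega> \<beta> x0 x1)"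
    if "\<omega> = 1 / lmax" "\<beta> = (1 - sqrt (0.99 * lmin / lmax))\<^sup>2"
    using main(2)[of "1 / lmax" \<beta>] main(3-5) that by simp
qed simp

end
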